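(* Let $1<p<\infty$, $\theta\in(0,1)$ and $k>1$. Let $\delta_0>0$ (depending on $\theta,k$) be such that for every $\delta\in(0,\delta_0)$ and every $a\in C^2([0,\infty)\times\mathbf{R})$ satisfying $$|\partial_t^{\alpha}\partial_x^{\beta}a(t,x)|\le \frac{\delta}{(1+t)^{k+\alpha}}\quad(\alpha,\beta\in\{0,1\},\ (t,x)\in[0,\infty)\times\mathbf{R}) \qquad (\mathrm{A})$$ there is a solution $h\in C^2([0,\infty)\times\mathbf{R})$ of $$h_{tt}-h_{xx}-a\,h_t-a_t(1+h)=0\quad\text{on }[0,\infty)\times\mathbf{R}\qquad (\mathrm{H})$$ satisfying, for some constant $C>0$ and all $(t,x)\in[0,\infty)\times\mathbf{R}$, $$|h(t,x)|\le \frac{\theta}{(1+t)^{k-1}},\qquad |h_t(t,x)|+|h_x(t,x)|\le\frac{C}{(1+t)^{k}}\qquad (\mathrm{B})$$ (such a $\delta_0$ exists). Let $\delta\in(0,\delta_0)$, let $a\in C^2([0,\infty)\times\mathbf{R})$ satisfy (A), let $h$ be such a solution of (H) satisfying (B), and put $g(t,x)=1+h(t,x)$. Let $(u_0,u_1)\in H^1(\mathbf{R})\times L^2(\mathbf{R})$ satisfy $$\liminf_{R\to\infty}\int_{-R}^{R}\Big(\big(-g_t(0,x)+g(0,x)a(0,x)\big)u_0(x)+g(0,x)u_1(x)\Big)\,dx>0 .$$ Then the local solution $u$ of $$u_{tt}-u_{xx}+a(t,x)u_t=|u|^p,\quad (t,x)\in(0,\infty)\times\mathbf{R},\qquad (u,u_t)(0,x)=(u_0,u_1)(x),$$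 blows up in finite time, that is, $\lim_{t\to T^*-0}\|(u,u_t)(t)\|_{H^1\times L^2}=+\infty$ for some $T^*\in(0,+\infty)$.
   Context: For $T\in(0,\infty]$ let $X(T)=C([0,T);H^1(\mathbf{R}))\cap C^1([0,T);L^2(\mathbf{R}))$. A real-valued $u\in X(T)$ is a solution of the initial value problem on $[0,T)$ if for every $\psi\in C_0^2([0,T)\times\mathbf{R})$ (compact support in $[0,T)\times\mathbf{R}$, not necessarily vanishing at $t=0$) $$\int_{[0,T)\times\mathbf{R}}u\,(\partial_t^2\psi-\partial_x^2\psi-\partial_t(a\psi))\,dx\,dt=\int_{\mathbf{R}}\{(a(0,x)u_0(x)+u_1(x))\psi(0,x)-u_0(x)\partial_t\psi(0,x)\}\,dx+\int_{[0,T)\times\mathbf{R}}|u|^p\psi\,dx\,dt .$$ If $T=\infty$, $u$ is a global solution. Known local existence (may be assumed): for $1<p<\infty$ and $(u_0,u_1)\in H^1(\mathbf{R})\times L^2(\mathbf{R})$ there exist a (maximal) $T^*\in(0,+\infty]$ and a unique solution $u\in X(T^* )$, called the local solution; moreover if $T^*<+\infty$ then $\lim_{t\to T^*-0}\|(u,u_t)(t)\|_{H^1\times L^2}=+\infty$. *)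

theory Defs
  imports "HOL-Analysis.Analysis"
begin

section \<open>The function spaces \<open>L\<^sup>2\<close> and \<open>H\<^sup>1\<close> on the real line\<close>

text \<open>
  Elements of \<open>L\<^sup>2\<close> and \<open>H\<^sup>1\<close> are represented by Borel functions; every notion below depends only on
  the almost-everywhere class.
\<close>

definition in_L2 :: "(real \<Rightarrow> real) \<Rightarrow> bool" where
  "in_L2 f \<longleftrightarrow> f \<in> borel_measurable lborel \<and> integrable lborel (\<lambda>x. (f x)\<^sup>2)"

definition L2_norm :: "(real \<Rightarrow> real) \<Rightarrow> real" where
  "L2_norm f = sqrt (LINT x|lborel. (f x)\<^sup>2)"

text \<open>
  On the line, testing against compactly supported functions of class \<open>C\<^sup>1\<close> gives the same weak
  derivative as testing against smooth ones.
\<close>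

definition has_weak_deriv :: "(real \<Rightarrow> real) \<Rightarrow> (real \<Rightarrow> real) \<Rightarrow> bool" where
  "has_weak_deriv f f' \<longleftrightarrow>
     (\<forall>\<phi>. \<phi> C1_differentiable_on UNIV \<and> compact (closure {x. \<phi> x \<noteq> 0}) \<longrightarrow>
        (LINT x|lborel. f x * deriv \<phi> x) = - (LINT x|lborel. f' x * \<phi> x))"

definition in_H1 :: "(real \<Rightarrow> real) \<Rightarrow> bool" where
  "in_H1 f \<longleftrightarrow> in_L2 f \<and> (\<exists>f'. in_L2 f' \<and> has_weak_deriv f f')"

definition weak_deriv :: "(real \<Rightarrow> real) \<Rightarrow> real \<Rightarrow> real" where
  "weak_deriv f = (SOME f'. in_L2 f' \<and> has_weak_deriv f f')"

definition H1_norm :: "(real \<Rightarrow> real) \<Rightarrow> real" where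
  "H1_norm f = sqrt ((L2_norm f)\<^sup>2 + (L2_norm (weak_deriv f))\<^sup>2)"

section \<open>Classical regularity on the closed half plane\<close>

text \<open>
  Functions of \<open>(t, x)\<close> are curried. Only the values for \<open>t \<ge> 0\<close> matter, so the time derivative at
  \<open>t = 0\<close> is one-sided.
\<close>

definition dt :: "(real \<Rightarrow> real \<Rightarrow> real) \<Rightarrow> real \<Rightarrow> real \<Rightarrow> real" where
  "dt f t x = vector_derivative (\<lambda>s. f s x) (at t within {0..})"

definition dx :: "(real \<Rightarrow> real \<Rightarrow> real) \<Rightarrow> real \<Rightarrow> real \<Rightarrow> real" where
  "dx f t x = vector_derivative (\<lambda>y. f t y) (at x)"

definition C1_halfplane :: "(real \<Rightarrow> real \<Rightarrow> real) \<Rightarrow> bool" where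
  "C1_halfplane f \<longleftrightarrow>
     (\<forall>t\<ge>0. \<forall>x. (\<lambda>s. f s x) differentiable (at t within {0..}) \<and> (\<lambda>y. f t y) differentiable (at x)) \<and>
     continuous_on ({0..} \<times> UNIV) (\<lambda>(t, x). f t x) \<and>
     continuous_on ({0..} \<times> UNIV) (\<lambda>(t, x). dt f t x) \<and>
     continuous_on ({0..} \<times> UNIV) (\<lambda>(t, x). dx f t x)"

definition C2_halfplane :: "(real \<Rightarrow> real \<Rightarrow> real) \<Rightarrow> bool" where
  "C2_halfplane f \<longleftrightarrow> C1_halfplane f \<and> C1_halfplane (dt f) \<and> C1_halfplane (dx f)"

section \<open>Weak solutions of the initial value problem\<close>

definition time_interval :: "ereal \<Rightarrow> real set" where
  "time_interval T = {t. 0 \<le> t \<and> ereal t < T}"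

text \<open>
  \<open>C\<^sub>0\<^sup>2([0,T) \<times> \<real>)\<close>: a test function is extended by zero to the half plane; it need not vanish at
  \<open>t = 0\<close>.
\<close>

definition test_function :: "ereal \<Rightarrow> (real \<Rightarrow> real \<Rightarrow> real) \<Rightarrow> bool" where
  "test_function T \<psi> \<longleftrightarrow> C2_halfplane \<psi> \<and>
     compact (closure {(t, x). 0 \<le> t \<and> \<psi> t x \<noteq> 0}) \<and>
     closure {(t, x). 0 \<le> t \<and> \<psi> t x \<noteq> 0} \<subseteq> time_interval T \<times> UNIV"

definition norm_continuous :: "((real \<Rightarrow> real) \<Rightarrow> real) \<Rightarrow> real set \<Rightarrow> (real \<Rightarrow> real \<Rightarrow> real) \<Rightarrow> bool" where
  "norm_continuous N I u \<longleftrightarrow>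
     (\<forall>t\<in>I. ((\<lambda>s. N (\<lambda>x. u s x - u t x)) \<longlongrightarrow> 0) (at t within I))"

definition has_L2_time_deriv :: "real set \<Rightarrow> (real \<Rightarrow> real \<Rightarrow> real) \<Rightarrow> real \<Rightarrow> (real \<Rightarrow> real) \<Rightarrow> bool" where
  "has_L2_time_deriv I u t w \<longleftrightarrow> in_L2 w \<and>
     ((\<lambda>s. L2_norm (\<lambda>x. (u s x - u t x) / (s - t) - w x)) \<longlongrightarrow> 0) (at t within I)"

definition L2_time_deriv :: "real set \<Rightarrow> (real \<Rightarrow> real \<Rightarrow> real) \<Rightarrow> real \<Rightarrow> real \<Rightarrow> real" where
  "L2_time_deriv I u t = (SOME w. has_L2_time_deriv I u t w)"

text \<open>
  \<open>X(T) = C([0,T); H\<^sup>1) \<inter> C\<^sup>1([0,T); L\<^sup>2)\<close>. Joint measurability selects a representative for which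
  integrals over space-time make sense; such a representative always exists.
\<close>

definition in_X :: "ereal \<Rightarrow> (real \<Rightarrow> real \<Rightarrow> real) \<Rightarrow> bool" where
  "in_X T u \<longleftrightarrow>
     set_borel_measurable lborel (time_interval T \<times> UNIV) (\<lambda>(t, x). u t x) \<and>
     (\<forall>t\<in>time_interval T. in_H1 (u t)) \<and>
     norm_continuous H1_norm (time_interval T) u \<and>
     (\<exists>v. (\<forall>t\<in>time_interval T. has_L2_time_deriv (time_interval T) u t (v t)) \<and>
          norm_continuous L2_norm (time_interval T) v)"

text \<open>The norm of \<open>(u, u\<^sub>t)(t)\<close> in \<open>H\<^sup>1 \<times> L\<^sup>2\<close>.\<close>

definition energy_norm :: "ereal \<Rightarrow> (real \<Rightarrow> real \<Rightarrow> real) \<Rightarrow> real \<Rightarrow> real" where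
  "energy_norm T u t =
     sqrt ((H1_norm (u t))\<^sup>2 + (L2_norm (L2_time_deriv (time_interval T) u t))\<^sup>2)"

definition solution_on ::
    "real \<Rightarrow> (real \<Rightarrow> real \<Rightarrow> real) \<Rightarrow> (real \<Rightarrow> real) \<Rightarrow> (real \<Rightarrow> real) \<Rightarrow> ereal \<Rightarrow>
     (real \<Rightarrow> real \<Rightarrow> real) \<Rightarrow> bool" where
  "solution_on p a u0 u1 T u \<longleftrightarrow> in_X T u \<and>
     (\<forall>\<psi>. test_function T \<psi> \<longrightarrow>
        (LINT (t, x):time_interval T \<times> UNIV|lborel.
            u t x * (dt (dt \<psi>) t x - dx (dx \<psi>) t x - dt (\<lambda>s y. a s y * \<psi> s y) t x))
        = (LINT x|lborel. (a 0 x * u0 x + u1 x) * \<psi> 0 x - u0 x * dt \<psi> 0 x)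
          + (LINT (t, x):time_interval T \<times> UNIV|lborel. \<bar>u t x\<bar> powr p * \<psi> t x))"

definition local_solution ::
    "real \<Rightarrow> (real \<Rightarrow> real \<Rightarrow> real) \<Rightarrow> (real \<Rightarrow> real) \<Rightarrow> (real \<Rightarrow> real) \<Rightarrow> ereal \<Rightarrow>
     (real \<Rightarrow> real \<Rightarrow> real) \<Rightarrow> bool" where
  "local_solution p a u0 u1 T u \<longleftrightarrow> 0 < T \<and> solution_on p a u0 u1 T u \<and>
     \<not> (\<exists>T' v. T < T' \<and> solution_on p a u0 u1 T' v)"

text \<open>
  The conclusion of the classical local existence theorem for the given \<open>p\<close> and \<open>a\<close>: existence and
  uniqueness of the maximal solution, together with the blow-up alternative.
\<close>

definition local_existence :: "real \<Rightarrow> (real \<Rightarrow> real \<Rightarrow> real) \<Rightarrow> bool" where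
  "local_existence p a \<longleftrightarrow>
     (\<forall>u0 u1. in_H1 u0 \<and> in_L2 u1 \<longrightarrow>
        (\<exists>T u. local_solution p a u0 u1 T u \<and>
           (\<forall>v. solution_on p a u0 u1 T v \<longrightarrow>
              (\<forall>t\<in>time_interval T. AE x in lborel. v t x = u t x)) \<and>
           (\<forall>Ts::real. T = ereal Ts \<longrightarrow> filterlim (energy_norm T u) at_top (at_left Ts))))"

section \<open>Conditions on the damping coefficient and the auxiliary function\<close>

definition decay_A :: "real \<Rightarrow> real \<Rightarrow> (real \<Rightarrow> real \<Rightarrow> real) \<Rightarrow> bool" where
  "decay_A k \<delta> a \<longleftrightarrow>
     (\<forall>\<alpha>\<in>{0, 1::nat}. \<forall>\<beta>\<in>{0, 1::nat}. \<forall>t\<ge>0. \<forall>x.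
        \<bar>(dt ^^ \<alpha>) ((dx ^^ \<beta>) a) t x\<bar> \<le> \<delta> / (1 + t) powr (k + real \<alpha>))"

definition equation_H :: "(real \<Rightarrow> real \<Rightarrow> real) \<Rightarrow> (real \<Rightarrow> real \<Rightarrow> real) \<Rightarrow> bool" where
  "equation_H a h \<longleftrightarrow>
     (\<forall>t\<ge>0. \<forall>x. dt (dt h) t x - dx (dx h) t x - a t x * dt h t x - dt a t x * (1 + h t x) = 0)"

definition bound_B :: "real \<Rightarrow> real \<Rightarrow> (real \<Rightarrow> real \<Rightarrow> real) \<Rightarrow> bool" where
  "bound_B \<theta> k h \<longleftrightarrow>
     (\<exists>C>0. \<forall>t\<ge>0. \<forall>x. \<bar>h t x\<bar> \<le> \<theta> / (1 + t) powr (k - 1) \<and>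
                       \<bar>dt h t x\<bar> + \<bar>dx h t x\<bar> \<le> C / (1 + t) powr k)"

end

theory Submission
  imports Defs
begin

text \<open>
  Suppose the solution is global. The function \<open>g = 1 + h\<close> solves the adjoint linear equation, so the
  weak formulation tested with \<open>g\<close> times a cutoff \<open>\<phi>((t\<^sup>2 + x\<^sup>2) / R\<^sup>2)\<close> only retains terms with
  derivatives of \<open>\<phi>\<close>, and by the decay of \<open>a\<close>, \<open>h\<^sub>t\<close>, \<open>h\<^sub>x\<close> these are \<open>O(1 / ((1 + t) * R))\<close>. If \<open>\<phi>\<close> is
  a high power, Young's inequality absorbs them into \<open>|u|\<^sup>p\<close> times the test function up to a remainder
  \<open>O(R powr (1 - q))\<close>, where \<open>q > 1\<close> is conjugate to \<open>p\<close>. Hence the cut-off data functional has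
  nonpositive limsup. But that functional is an average of the truncated integrals over \<open>[-r, r]\<close>
  with \<open>r \<ge> R\<close>, whose liminf is positive.

  The space-time integrals of \<open>u\<close> and \<open>|u|\<^sup>p\<close> over compact sets are finite because \<open>H\<^sup>1\<close> embeds into
  locally bounded functions; this is obtained by duality against continuous functions.
\<close>

section \<open>Calculus on the half plane\<close>

text \<open>The obstacle is the adjoint damping term: tested with a bare cutoff it leaves
  \<open>dt a\<close> times the cutoff itself, which gains no power of \<open>R\<close>. The factor
  \<open>g\<close> is chosen to remove exactly this, and theta < 1 keeps \<open>g\<close> above 1 -
  theta > 0, so that the nonlinear term can absorb Young's first term with that weight. The
  remainder is the \<open>q\<close>-th power of \<open>1 / ((1 + t) * R)\<close> over a box with
  sides of order \<open>R\<close>. Its time integral converges because q > 1, which leaves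
  \<open>R powr (- q)\<close> times the width \<open>R\<close>; the exponent 1 - q is negative for
  every p > 1, so no upper bound on \<open>p\<close> arises. The cutoff is even in \<open>t\<close>,
  so its time derivative vanishes at t = 0 and the data functional sees only \<open>g\<close> and
  \<open>dt g\<close>. The data density is only locally integrable (\<open>u1\<close> is merely in
  L2), so the limit cannot be taken under the integral sign; this is why truncated integrals are
  averaged. At the end, the blow-up alternative is available for one representative of the maximal
  solution and has to be carried over to the given one, through norms that are defined with a choice
  operator.\<close>

lemma dt_eqI:
  assumes "((\<lambda>s. f s x) has_real_derivative D) (at t within {0..})" and "0 \<le> t"
  shows "dt f t x = D"
proof -
  have "at t within {0..} \<noteq> bot"
  proof -
    have "at t within {t<..} \<le> at t within {0..}"
      using \<open>0 \<le> t\<close> by (intro at_le) auto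
    moreover have "at t within {t<..} \<noteq> bot"
      by (simp add: trivial_limit_at_right_real)
    ultimately show ?thesis
      by (metis bot.extremum_uniqueI)
  qed
  then show ?thesis
    using assms(1) unfolding dt_def has_real_derivative_iff_has_vector_derivative
    by (rule vector_derivative_within)
qed

lemma dx_eqI:
  assumes "((\<lambda>y. f t y) has_real_derivative D) (at x)"
  shows "dx f t x = D"
  using assms unfolding dx_def has_real_derivative_iff_has_vector_derivative
  by (rule vector_derivative_at)

lemma C1_halfplane_dt:
  assumes "C1_halfplane f" and "0 \<le> t"
  shows "((\<lambda>s. f s x) has_real_derivative dt f t x) (at t within {0..})"
  using assms unfolding C1_halfplane_def dt_def has_real_derivative_iff_has_vector_derivative
  by (simp add: vector_derivative_works)

lemma C1_halfplane_dx:
  assumes "C1_halfplane f" and "0 \<le> t"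
  shows "((\<lambda>y. f t y) has_real_derivative dx f t x) (at x)"
  using assms unfolding C1_halfplane_def dx_def has_real_derivative_iff_has_vector_derivative
  by (simp add: vector_derivative_works)

text \<open>Explicit candidates \<open>ft\<close>, \<open>fx\<close> are easier to prove continuous
  than \<open>dt f\<close>, \<open>dx f\<close>; uniqueness of derivatives identifies them on the
  half plane.\<close>

lemma C1_halfplaneI:
  assumes t: "\<And>t x. 0 \<le> t \<Longrightarrow> ((\<lambda>s. f s x) has_real_derivative ft t x) (at t within {0..})"
    and x: "\<And>t x. 0 \<le> t \<Longrightarrow> ((\<lambda>y. f t y) has_real_derivative fx t x) (at x)"
    and c: "continuous_on ({0..} \<times> UNIV) (\<lambda>(t, x). f t x)"
      "continuous_on ({0..} \<times> UNIV) (\<lambda>(t, x). ft t x)"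
      "continuous_on ({0..} \<times> UNIV) (\<lambda>(t, x). fx t x)"
  shows "C1_halfplane f"
proof -
  have "continuous_on ({0..} \<times> UNIV) (\<lambda>(t, x). dt f t x)"
    using c(2) by (rule continuous_on_eq) (auto simp: dt_eqI[OF t])
  moreover have "continuous_on ({0..} \<times> UNIV) (\<lambda>(t, x). dx f t x)"
    using c(3) by (rule continuous_on_eq) (auto simp: dx_eqI[where f = f, OF x])
  moreover have "\<forall>t\<ge>0. \<forall>x. (\<lambda>s. f s x) differentiable (at t within {0..}) \<and> (\<lambda>y. f t y) differentiable (at x)"
    using t x by (meson field_differentiable_imp_differentiable field_differentiable_def)
  ultimately show ?thesis
    using c(1) by (simp add: C1_halfplane_def)
qed

text \<open>The one-sided time derivative never looks at negative times. The congruence is needed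
  because formulas such as \<open>dt_mult\<close> hold only for t \<ge> 0, so that \<open>dt\<close>
  of a product equals the product rule expression only there.\<close>

lemma C1_halfplane_cong:
  assumes "C1_halfplane f" and eq: "\<And>t x. 0 \<le> t \<Longrightarrow> f' t x = f t x"
  shows "C1_halfplane f'"
proof (rule C1_halfplaneI)
  show "((\<lambda>s. f' s x) has_real_derivative dt f t x) (at t within {0..})" if "0 \<le> t" for t x
    using C1_halfplane_dt[OF assms(1) that, of x]
    by (rule has_field_derivative_transform_within[where d = 1]) (use eq that in auto)
  show "((\<lambda>y. f' t y) has_real_derivative dx f t x) (at x)" if "0 \<le> t" for t x
    using C1_halfplane_dx[OF assms(1) that] eq that by simp
  show "continuous_on ({0..} \<times> UNIV) (\<lambda>(t, x). f' t x)"
    using assms(1) by (auto simp: C1_halfplane_def eq intro: continuous_on_eq)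
qed (use assms(1) in \<open>simp_all add: C1_halfplane_def\<close>)

section \<open>Sum and product rules up to second order\<close>

lemma dt_mult:
  assumes "C1_halfplane f" "C1_halfplane g" "0 \<le> t"
  shows "dt (\<lambda>s y. f s y * g s y) t x = dt f t x * g t x + f t x * dt g t x"
  using DERIV_mult[OF C1_halfplane_dt[OF assms(1,3)] C1_halfplane_dt[OF assms(2,3)]]
  by (intro dt_eqI) (use assms(3) in \<open>simp_all add: algebra_simps\<close>)

lemma dx_mult:
  assumes "C1_halfplane f" "C1_halfplane g" "0 \<le> t"
  shows "dx (\<lambda>s y. f s y * g s y) t x = dx f t x * g t x + f t x * dx g t x"
  using DERIV_mult[OF C1_halfplane_dx[OF assms(1,3)] C1_halfplane_dx[OF assms(2,3)]]
  by (intro dx_eqI) (simp add: algebra_simps)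

lemma dt_add:
  assumes "C1_halfplane f" "C1_halfplane g" "0 \<le> t"
  shows "dt (\<lambda>s y. f s y + g s y) t x = dt f t x + dt g t x"
  using DERIV_add[OF C1_halfplane_dt[OF assms(1,3)] C1_halfplane_dt[OF assms(2,3)]] assms(3)
  by (rule dt_eqI)

lemma dx_add:
  assumes "C1_halfplane f" "C1_halfplane g" "0 \<le> t"
  shows "dx (\<lambda>s y. f s y + g s y) t x = dx f t x + dx g t x"
  using DERIV_add[OF C1_halfplane_dx[OF assms(1,3)] C1_halfplane_dx[OF assms(2,3)]]
  by (rule dx_eqI)

lemma dt_cong:
  assumes "C1_halfplane f" and "\<And>t x. 0 \<le> t \<Longrightarrow> f' t x = f t x" and "0 \<le> t"
  shows "dt f' t x = dt f t x"
proof (rule dt_eqI)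
  show "((\<lambda>s. f' s x) has_real_derivative dt f t x) (at t within {0..})"
    using C1_halfplane_dt[OF assms(1,3), of x]
    by (rule has_field_derivative_transform_within[where d = 1]) (use assms in auto)
qed fact

lemma dx_cong:
  assumes "\<And>t x. 0 \<le> t \<Longrightarrow> f' t x = f t x" and "0 \<le> t"
  shows "dx f' t x = dx f t x"
proof -
  have "(\<lambda>y. f' t y) = (\<lambda>y. f t y)"
    using assms by auto
  then show ?thesis
    unfolding dx_def by simp
qed

lemma C1_halfplane_continuous:
  assumes "C1_halfplane f"
  shows "continuous_on ({0..} \<times> UNIV) (\<lambda>z. f (fst z) (snd z))"
    "continuous_on ({0..} \<times> UNIV) (\<lambda>z. dt f (fst z) (snd z))"
    "continuous_on ({0..} \<times> UNIV) (\<lambda>z. dx f (fst z) (snd z))"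
  using assms by (simp_all add: C1_halfplane_def case_prod_unfold)

lemma C1_halfplane_mult:
  assumes "C1_halfplane f" "C1_halfplane g"
  shows "C1_halfplane (\<lambda>t x. f t x * g t x)"
  by (rule C1_halfplaneI[where ft = "\<lambda>t x. dt f t x * g t x + dt g t x * f t x"
        and fx = "\<lambda>t x. dx f t x * g t x + dx g t x * f t x"])
    (auto intro!: DERIV_mult C1_halfplane_dt C1_halfplane_dx continuous_intros assms
      C1_halfplane_continuous[OF assms(1)] C1_halfplane_continuous[OF assms(2)] simp: case_prod_unfold)

lemma C1_halfplane_add:
  assumes "C1_halfplane f" "C1_halfplane g"
  shows "C1_halfplane (\<lambda>t x. f t x + g t x)"
  by (rule C1_halfplaneI[where ft = "\<lambda>t x. dt f t x + dt g t x"
        and fx = "\<lambda>t x. dx f t x + dx g t x"])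
    (auto intro!: DERIV_add C1_halfplane_dt C1_halfplane_dx continuous_intros assms
      C1_halfplane_continuous[OF assms(1)] C1_halfplane_continuous[OF assms(2)] simp: case_prod_unfold)

lemma C2_halfplaneD:
  assumes "C2_halfplane f"
  shows "C1_halfplane f" "C1_halfplane (dt f)" "C1_halfplane (dx f)"
  using assms by (simp_all add: C2_halfplane_def)

lemma C2_halfplane_mult:
  assumes f: "C2_halfplane f" and g: "C2_halfplane g"
  shows "C2_halfplane (\<lambda>t x. f t x * g t x)"
proof -
  note C = C2_halfplaneD[OF f] C2_halfplaneD[OF g]
  have "C1_halfplane (dt (\<lambda>t x. f t x * g t x))"
    by (rule C1_halfplane_cong[where f = "\<lambda>t x. dt f t x * g t x + f t x * dt g t x"])
      (auto intro!: C1_halfplane_add C1_halfplane_mult C simp: dt_mult[OF C(1,4)])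
  moreover have "C1_halfplane (dx (\<lambda>t x. f t x * g t x))"
    by (rule C1_halfplane_cong[where f = "\<lambda>t x. dx f t x * g t x + f t x * dx g t x"])
      (auto intro!: C1_halfplane_add C1_halfplane_mult C simp: dx_mult[OF C(1,4)])
  ultimately show ?thesis
    using C by (auto simp: C2_halfplane_def intro!: C1_halfplane_mult)
qed

lemma dt_dt_mult:
  assumes f: "C2_halfplane f" and g: "C2_halfplane g" and "0 \<le> t"
  shows "dt (dt (\<lambda>s y. f s y * g s y)) t x
    = dt (dt f) t x * g t x + 2 * dt f t x * dt g t x + f t x * dt (dt g) t x"
proof -
  note C = C2_halfplaneD[OF f] C2_halfplaneD[OF g]
  have "dt (dt (\<lambda>s y. f s y * g s y)) t x = dt (\<lambda>t x. dt f t x * g t x + f t x * dt g t x) t x"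
    using assms(3) by (intro dt_cong C1_halfplane_add C1_halfplane_mult C) (simp add: dt_mult[OF C(1,4)])
  also have "\<dots> = dt (\<lambda>t x. dt f t x * g t x) t x + dt (\<lambda>t x. f t x * dt g t x) t x"
    using assms(3) by (intro dt_add C1_halfplane_mult C)
  also have "\<dots> = dt (dt f) t x * g t x + 2 * dt f t x * dt g t x + f t x * dt (dt g) t x"
    by (simp add: dt_mult[OF C(2,4) assms(3)] dt_mult[OF C(1,5) assms(3)])
  finally show ?thesis .
qed

lemma dx_dx_mult:
  assumes f: "C2_halfplane f" and g: "C2_halfplane g" and "0 \<le> t"
  shows "dx (dx (\<lambda>s y. f s y * g s y)) t x
    = dx (dx f) t x * g t x + 2 * dx f t x * dx g t x + f t x * dx (dx g) t x"
proof -
  note C = C2_halfplaneD[OF f] C2_halfplaneD[OF g]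
  have "dx (dx (\<lambda>s y. f s y * g s y)) t x = dx (\<lambda>t x. dx f t x * g t x + f t x * dx g t x) t x"
    using assms(3) by (intro dx_cong) (simp_all add: dx_mult[OF C(1,4)])
  also have "\<dots> = dx (\<lambda>t x. dx f t x * g t x) t x + dx (\<lambda>t x. f t x * dx g t x) t x"
    using assms(3) by (intro dx_add C1_halfplane_mult C)
  also have "\<dots> = dx (dx f) t x * g t x + 2 * dx f t x * dx g t x + f t x * dx (dx g) t x"
    by (simp add: dx_mult[OF C(3,4) assms(3)] dx_mult[OF C(1,6) assms(3)])
  finally show ?thesis .
qed

lemma C1_halfplane_const: "C1_halfplane (\<lambda>_ _. c)"
  by (rule C1_halfplaneI[where ft = "\<lambda>_ _. 0" and fx = "\<lambda>_ _. 0"]) (auto simp: case_prod_unfold)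

lemma one_plus_halfplane:
  assumes "C2_halfplane h"
  shows "C2_halfplane (\<lambda>t x. 1 + h t x)"
    and "\<And>t x. 0 \<le> t \<Longrightarrow> dt (\<lambda>t x. 1 + h t x) t x = dt h t x"
    and "\<And>t x. 0 \<le> t \<Longrightarrow> dx (\<lambda>t x. 1 + h t x) t x = dx h t x"
    and "\<And>t x. 0 \<le> t \<Longrightarrow> dt (dt (\<lambda>t x. 1 + h t x)) t x = dt (dt h) t x"
    and "\<And>t x. 0 \<le> t \<Longrightarrow> dx (dx (\<lambda>t x. 1 + h t x)) t x = dx (dx h) t x"
proof -
  note C = C2_halfplaneD[OF assms]
  have "dt (\<lambda>_ _. 1) t x = 0" if "0 \<le> t" for t x
    by (rule dt_eqI[OF _ that]) simp
  then show t: "dt (\<lambda>t x. 1 + h t x) t x = dt h t x" if "0 \<le> t" for t x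
    using dt_add[OF C1_halfplane_const C(1) that, of 1 x] that by simp
  have "dx (\<lambda>_ _. 1) t x = 0" for t x
    by (rule dx_eqI) simp
  then show x: "dx (\<lambda>t x. 1 + h t x) t x = dx h t x" if "0 \<le> t" for t x
    using dx_add[OF C1_halfplane_const C(1) that, of 1 x] by simp
  show "C2_halfplane (\<lambda>t x. 1 + h t x)"
    unfolding C2_halfplane_def
    using C1_halfplane_add[OF C1_halfplane_const C(1)] C1_halfplane_cong[OF C(2) t] C1_halfplane_cong[OF C(3) x]
    by blast
  show "dt (dt (\<lambda>t x. 1 + h t x)) t x = dt (dt h) t x" if "0 \<le> t" for t x
    by (rule dt_cong[OF C(2) t that])
  show "dx (dx (\<lambda>t x. 1 + h t x)) t x = dx (dx h) t x" if "0 \<le> t" for t x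
    by (rule dx_cong[OF x that])
qed

section \<open>The cutoff function\<close>

lemma DERIV_max_power:
  fixes y :: real
  assumes "2 \<le> n"
  shows "((\<lambda>y. max 0 y ^ n) has_real_derivative real n * max 0 y ^ (n - 1)) (at y)"
proof -
  consider "y < 0" | "y = 0" | "0 < y" by linarith
  then show ?thesis
  proof cases
    case 1
    have "((\<lambda>_. 0) has_real_derivative real n * max 0 y ^ (n - 1)) (at y)"
      using 1 assms by (simp add: power_0_left)
    then show ?thesis
      by (rule has_field_derivative_transform_within_open[where S = "{..<0}"])
        (use 1 assms in auto)
  next
    case 2
    \<comment> \<open>At the kink the difference quotient is h * h^(n - 2) for h > 0 and zero for h
      < 0; hence it is at most |h| as soon as |h| < 1.\<close>
    have "((\<lambda>h::real. max 0 h ^ n / h) \<longlongrightarrow> 0) (at 0)"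
    proof (rule Lim_null_comparison)
      show "\<forall>\<^sub>F h in at 0. norm (max 0 h ^ n / h) \<le> \<bar>h\<bar>"
      proof -
        have "\<forall>\<^sub>F h in at 0. \<bar>h\<bar> < (1::real)"
          using eventually_at[of _ "0::real" UNIV] by (auto simp: dist_real_def intro: exI[of _ 1])
        then show ?thesis
        proof eventually_elim
          case (elim h)
          show ?case
          proof (cases "0 < h")
            case True
            have "h ^ n = h * h * h ^ (n - 2)"
              using assms by (metis le_add_diff_inverse mult.assoc power_add power2_eq_square)
            moreover have "h ^ (n - 2) \<le> 1"
              using True elim by (intro power_le_one) auto
            ultimately show ?thesis
              using True by (simp add: max_def mult_left_le)
          qed (use assms in \<open>simp add: power_0_left\<close>)
        qed
      qed
    qed (auto intro!: tendsto_eq_intros)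
    then show ?thesis
      using 2 assms by (simp add: DERIV_def power_0_left)
  next
    case 3
    have "((\<lambda>y. y ^ n) has_real_derivative real n * max 0 y ^ (n - 1)) (at y)"
      using 3 by (auto intro!: derivative_eq_intros simp: max_def)
    then show ?thesis
      by (rule has_field_derivative_transform_within_open[where S = "{0<..}"])
        (use 3 in auto)
  qed
qed

text \<open>A spline that equals 1 up to s = 1, reaches 0 at s = 2 and is negative beyond. The
  exponent 3 is the smallest that makes the junction at s = 1 of class C2; the junction at s = 2 is
  smoothed by the outer power in \<open>cutoff_pow\<close>.\<close>

definition cutoff_base :: "real \<Rightarrow> real" where
  "cutoff_base s = 1 - max 0 (s - 1) ^ 3"

definition cutoff_pow :: "nat \<Rightarrow> real \<Rightarrow> real" where
  "cutoff_pow n s = max 0 (cutoff_base s) ^ n"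

definition cutoff_deriv :: "nat \<Rightarrow> real \<Rightarrow> real" where
  "cutoff_deriv n s = - (3 * real n) * cutoff_pow (n - 1) s * max 0 (s - 1) ^ 2"

text \<open>Each differentiation lowers the power of the truncated base by one. The surviving power
  n - 2 is what Young's inequality later compares with the power n in the nonlinear term.\<close>

definition cutoff_deriv2 :: "nat \<Rightarrow> real \<Rightarrow> real" where
  "cutoff_deriv2 n s = 9 * real n * real (n - 1) * cutoff_pow (n - 2) s * max 0 (s - 1) ^ 4
     - 6 * real n * cutoff_pow (n - 1) s * max 0 (s - 1)"

lemma DERIV_cutoff_base:
  "(cutoff_base has_real_derivative - 3 * max 0 (s - 1) ^ 2) (at s)"
proof -
  have "((\<lambda>s. max 0 (s - 1) ^ 3) has_real_derivative real 3 * max 0 (s - 1) ^ (3 - 1) * (1 - 0)) (at s)"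
    by (rule DERIV_chain2[OF DERIV_max_power]) (auto intro!: derivative_eq_intros)
  from DERIV_diff[OF DERIV_const[of 1] this] show ?thesis
    unfolding cutoff_base_def[abs_def] by simp
qed

lemma DERIV_cutoff_pow:
  assumes "2 \<le> n"
  shows "(cutoff_pow n has_real_derivative cutoff_deriv n s) (at s)"
  using DERIV_chain2[OF DERIV_max_power[OF assms] DERIV_cutoff_base]
  unfolding cutoff_pow_def[abs_def] cutoff_deriv_def by (simp add: mult_ac)

lemma DERIV_cutoff_deriv:
  assumes "3 \<le> n"
  shows "(cutoff_deriv n has_real_derivative cutoff_deriv2 n s) (at s)"
proof -
  have 1: "((\<lambda>s. max 0 (s - 1) ^ 2) has_real_derivative real 2 * max 0 (s - 1) ^ (2 - 1) * (1 - 0)) (at s)"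
    by (rule DERIV_chain2[OF DERIV_max_power]) (auto intro!: derivative_eq_intros)
  have 2: "(cutoff_pow (n - 1) has_real_derivative cutoff_deriv (n - 1) s) (at s)"
    using assms by (intro DERIV_cutoff_pow) simp
  have "max 0 (s - 1) ^ 4 = max 0 (s - 1) ^ 2 * max 0 (s - 1) ^ 2"
    by (simp add: power_add[symmetric])
  then show ?thesis
    using DERIV_mult[OF DERIV_cmult[OF 2, of "- (3 * real n)"] 1] assms
    unfolding cutoff_deriv_def[abs_def] cutoff_deriv2_def
    by (simp add: algebra_simps numeral_2_eq_2)
qed

lemma cutoff_continuous [continuous_intros]:
  assumes "continuous_on S f"
  shows "continuous_on S (\<lambda>x. cutoff_pow n (f x))" "continuous_on S (\<lambda>x. cutoff_deriv n (f x))"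
    "continuous_on S (\<lambda>x. cutoff_deriv2 n (f x))"
  using assms unfolding cutoff_pow_def cutoff_base_def cutoff_deriv_def cutoff_deriv2_def
  by (auto intro!: continuous_intros)

lemma cutoff_base_le_1: "cutoff_base s \<le> 1"
  by (simp add: cutoff_base_def)

lemma cutoff_pow_nonneg: "0 \<le> cutoff_pow n s"
  by (simp add: cutoff_pow_def)

lemma cutoff_pow_le_1: "cutoff_pow n s \<le> 1"
  using cutoff_base_le_1[of s] by (auto simp: cutoff_pow_def intro!: power_le_one)

lemma cutoff_pow_antimono: "m \<le> n \<Longrightarrow> cutoff_pow n s \<le> cutoff_pow m s"
  using cutoff_base_le_1[of s] by (auto simp: cutoff_pow_def intro!: power_decreasing)

lemma cutoff_pow_eq_1: "s \<le> 1 \<Longrightarrow> cutoff_pow n s = 1"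
  by (simp add: cutoff_pow_def cutoff_base_def)

lemma cutoff_pow_eq_0:
  assumes "2 \<le> s" "0 < n"
  shows "cutoff_pow n s = 0"
proof -
  have "1 \<le> (s - 1) ^ 3"
    using assms by (intro one_le_power) simp
  then show ?thesis
    using assms by (simp add: cutoff_pow_def cutoff_base_def max_absorb1 max_absorb2)
qed

lemma cutoff_deriv_nonpos: "cutoff_deriv n s \<le> 0"
  by (simp add: cutoff_deriv_def cutoff_pow_nonneg)

text \<open>The constant 15 n^2 is dictated by the second derivative, as an upper bound for 9 n^2 +
  6 n, and is shared by both bounds, as is the power n - 2. For s \<ge> 2 everything vanishes, and
  for s < 2 the truncated factor lies in [0, 1].\<close>

lemma cutoff_deriv_bound:
  assumes "3 \<le> n"
  shows "\<bar>cutoff_deriv n s\<bar> \<le> 15 * (real n)\<^sup>2 * cutoff_pow (n - 2) s"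
proof (cases "2 \<le> s")
  case True
  then show ?thesis
    using assms by (simp add: cutoff_deriv_def cutoff_pow_eq_0)
next
  case False
  have m: "max 0 (s - 1) ^ j \<le> 1" for j
    using False by (intro power_le_one) auto
  have "\<bar>cutoff_deriv n s\<bar> = 3 * real n * (cutoff_pow (n - 1) s * max 0 (s - 1) ^ 2)"
    by (simp add: cutoff_deriv_def abs_mult cutoff_pow_nonneg)
  also have "\<dots> \<le> 3 * real n * (cutoff_pow (n - 2) s * 1)"
    using m[of 2] by (intro mult_left_mono mult_mono cutoff_pow_antimono) (auto simp: cutoff_pow_nonneg)
  also have "\<dots> \<le> 15 * (real n)\<^sup>2 * cutoff_pow (n - 2) s"
  proof -
    have "3 * real n \<le> 15 * (real n)\<^sup>2"
      using assms by (simp add: power2_eq_square)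
    then show ?thesis
      using mult_right_mono[of "3 * real n" "15 * (real n)\<^sup>2" "cutoff_pow (n - 2) s"]
      by (simp add: cutoff_pow_nonneg)
  qed
  finally show ?thesis .
qed

lemma cutoff_deriv2_bound:
  assumes "3 \<le> n"
  shows "\<bar>cutoff_deriv2 n s\<bar> \<le> 15 * (real n)\<^sup>2 * cutoff_pow (n - 2) s"
proof (cases "2 \<le> s")
  case True
  then show ?thesis
    using assms by (simp add: cutoff_deriv2_def cutoff_pow_eq_0)
next
  case False
  have m: "max 0 (s - 1) ^ j \<le> 1" for j
    using False by (intro power_le_one) auto
  have m1: "max 0 (s - 1) \<le> 1"
    using m[of 1] by simp
  have "\<bar>cutoff_deriv2 n s\<bar> \<le> \<bar>9 * real n * real (n - 1) * (cutoff_pow (n - 2) s * max 0 (s - 1) ^ 4)\<bar>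
     + \<bar>6 * real n * (cutoff_pow (n - 1) s * max 0 (s - 1))\<bar>"
    unfolding cutoff_deriv2_def using abs_triangle_ineq4 by (simp add: mult.assoc)
  also have "\<dots> = 9 * real n * real (n - 1) * (cutoff_pow (n - 2) s * max 0 (s - 1) ^ 4)
     + 6 * real n * (cutoff_pow (n - 1) s * max 0 (s - 1))"
    by (simp add: abs_mult cutoff_pow_nonneg)
  also have "\<dots> \<le> 9 * real n * real n * (cutoff_pow (n - 2) s * 1)
     + 6 * real n * (cutoff_pow (n - 2) s * 1)"
    using m[of 4] m1 by (intro add_mono mult_mono cutoff_pow_antimono) (auto simp: cutoff_pow_nonneg)
  also have "\<dots> \<le> 15 * (real n)\<^sup>2 * cutoff_pow (n - 2) s"
  proof -
    have "9 * real n * real n + 6 * real n \<le> 15 * (real n)\<^sup>2"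
      using assms by (simp add: power2_eq_square)
    then have "(9 * real n * real n + 6 * real n) * cutoff_pow (n - 2) s
        \<le> 15 * (real n)\<^sup>2 * cutoff_pow (n - 2) s"
      by (intro mult_right_mono) (simp_all add: cutoff_pow_nonneg)
    then show ?thesis
      by (simp add: algebra_simps)
  qed
  finally show ?thesis .
qed

section \<open>The space-time cutoff at scale R and the size of its derivatives\<close>

definition cutoff :: "nat \<Rightarrow> real \<Rightarrow> real \<Rightarrow> real \<Rightarrow> real" where
  "cutoff n R t x = cutoff_pow n ((t\<^sup>2 + x\<^sup>2) / R\<^sup>2)"

lemma DERIV_radius:
  "((\<lambda>s. (s\<^sup>2 + x\<^sup>2) / R\<^sup>2) has_real_derivative 2 * t / R\<^sup>2) (at t within S)"
  "((\<lambda>y. (t\<^sup>2 + y\<^sup>2) / R\<^sup>2) has_real_derivative 2 * x / R\<^sup>2) (at x within S)"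
  by (rule DERIV_cdivide, (auto intro!: derivative_eq_intros)[1])+

lemmas DERIV_cutoff_radius =
  DERIV_chain2[OF DERIV_cutoff_pow DERIV_radius(1)] DERIV_chain2[OF DERIV_cutoff_pow DERIV_radius(2)]
  DERIV_chain2[OF DERIV_cutoff_deriv DERIV_radius(1)] DERIV_chain2[OF DERIV_cutoff_deriv DERIV_radius(2)]

text \<open>\<open>R\<close> is arbitrary here, so division by its square is turned into
  multiplication by a constant inverse, whose continuity carries no side condition.\<close>

lemma cutoff_C1:
  assumes "2 \<le> n"
  shows "C1_halfplane (cutoff n R)"
  by (rule C1_halfplaneI[where ft = "\<lambda>t x. cutoff_deriv n ((t\<^sup>2 + x\<^sup>2) / R\<^sup>2) * (2 * t / R\<^sup>2)"
        and fx = "\<lambda>t x. cutoff_deriv n ((t\<^sup>2 + x\<^sup>2) / R\<^sup>2) * (2 * x / R\<^sup>2)"])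
    (unfold cutoff_def case_prod_unfold divide_inverse[of _ "R\<^sup>2"], use assms in
      \<open>auto intro!: DERIV_cutoff_radius[unfolded divide_inverse] continuous_intros\<close>)

lemma cutoff_dt:
  assumes "2 \<le> n" "0 \<le> t"
  shows "dt (cutoff n R) t x = cutoff_deriv n ((t\<^sup>2 + x\<^sup>2) / R\<^sup>2) * (2 * t / R\<^sup>2)"
  using DERIV_cutoff_radius(1)[OF assms(1)] assms(2) unfolding cutoff_def[abs_def] by (rule dt_eqI)

lemma cutoff_dx:
  assumes "2 \<le> n"
  shows "dx (cutoff n R) t x = cutoff_deriv n ((t\<^sup>2 + x\<^sup>2) / R\<^sup>2) * (2 * x / R\<^sup>2)"
  using DERIV_cutoff_radius(2)[OF assms(1)] unfolding cutoff_def[abs_def] by (rule dx_eqI)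

lemma cutoff_deriv_t_C1:
  assumes "3 \<le> n"
  shows "C1_halfplane (\<lambda>t x. cutoff_deriv n ((t\<^sup>2 + x\<^sup>2) / R\<^sup>2) * (2 * t / R\<^sup>2))"
    "\<And>t x. 0 \<le> t \<Longrightarrow> dt (\<lambda>t x. cutoff_deriv n ((t\<^sup>2 + x\<^sup>2) / R\<^sup>2) * (2 * t / R\<^sup>2)) t x
      = cutoff_deriv2 n ((t\<^sup>2 + x\<^sup>2) / R\<^sup>2) * (2 * t / R\<^sup>2)\<^sup>2
        + cutoff_deriv n ((t\<^sup>2 + x\<^sup>2) / R\<^sup>2) * (2 / R\<^sup>2)"
proof -
  have D: "((\<lambda>s. 2 * s / R\<^sup>2) has_real_derivative 2 / R\<^sup>2) (at t within S)" for t S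
    by (rule DERIV_cdivide) (auto intro!: derivative_eq_intros)
  have t: "((\<lambda>s. cutoff_deriv n ((s\<^sup>2 + x\<^sup>2) / R\<^sup>2) * (2 * s / R\<^sup>2)) has_real_derivative
      cutoff_deriv2 n ((t\<^sup>2 + x\<^sup>2) / R\<^sup>2) * (2 * t / R\<^sup>2)\<^sup>2
        + cutoff_deriv n ((t\<^sup>2 + x\<^sup>2) / R\<^sup>2) * (2 / R\<^sup>2)) (at t within {0..})" for t x
    by (rule DERIV_cong, rule DERIV_mult, rule DERIV_cutoff_radius(3)[OF assms], rule D)
      (simp add: power2_eq_square algebra_simps)
  have x: "((\<lambda>y. cutoff_deriv n ((t\<^sup>2 + y\<^sup>2) / R\<^sup>2) * (2 * t / R\<^sup>2)) has_real_derivative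
      cutoff_deriv2 n ((t\<^sup>2 + x\<^sup>2) / R\<^sup>2) * (2 * x / R\<^sup>2) * (2 * t / R\<^sup>2)) (at x)" for t x
    by (rule DERIV_cmult_right) (rule DERIV_cutoff_radius(4)[OF assms])
  show "C1_halfplane (\<lambda>t x. cutoff_deriv n ((t\<^sup>2 + x\<^sup>2) / R\<^sup>2) * (2 * t / R\<^sup>2))"
    by (rule C1_halfplaneI, rule t, rule x)
      (auto simp: case_prod_unfold divide_inverse[of _ "R\<^sup>2"] intro!: continuous_intros)
  show "dt (\<lambda>t x. cutoff_deriv n ((t\<^sup>2 + x\<^sup>2) / R\<^sup>2) * (2 * t / R\<^sup>2)) t x
      = cutoff_deriv2 n ((t\<^sup>2 + x\<^sup>2) / R\<^sup>2) * (2 * t / R\<^sup>2)\<^sup>2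
        + cutoff_deriv n ((t\<^sup>2 + x\<^sup>2) / R\<^sup>2) * (2 / R\<^sup>2)" if "0 \<le> t" for t x
    using t that by (rule dt_eqI)
qed

lemma cutoff_deriv_x_C1:
  assumes "3 \<le> n"
  shows "C1_halfplane (\<lambda>t x. cutoff_deriv n ((t\<^sup>2 + x\<^sup>2) / R\<^sup>2) * (2 * x / R\<^sup>2))"
    "\<And>t x. dx (\<lambda>t x. cutoff_deriv n ((t\<^sup>2 + x\<^sup>2) / R\<^sup>2) * (2 * x / R\<^sup>2)) t x
      = cutoff_deriv2 n ((t\<^sup>2 + x\<^sup>2) / R\<^sup>2) * (2 * x / R\<^sup>2)\<^sup>2
        + cutoff_deriv n ((t\<^sup>2 + x\<^sup>2) / R\<^sup>2) * (2 / R\<^sup>2)"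
proof -
  have D: "((\<lambda>y. 2 * y / R\<^sup>2) has_real_derivative 2 / R\<^sup>2) (at x within S)" for x S
    by (rule DERIV_cdivide) (auto intro!: derivative_eq_intros)
  have x: "((\<lambda>y. cutoff_deriv n ((t\<^sup>2 + y\<^sup>2) / R\<^sup>2) * (2 * y / R\<^sup>2)) has_real_derivative
      cutoff_deriv2 n ((t\<^sup>2 + x\<^sup>2) / R\<^sup>2) * (2 * x / R\<^sup>2)\<^sup>2
        + cutoff_deriv n ((t\<^sup>2 + x\<^sup>2) / R\<^sup>2) * (2 / R\<^sup>2)) (at x)" for t x
    by (rule DERIV_cong, rule DERIV_mult, rule DERIV_cutoff_radius(4)[OF assms], rule D)
      (simp add: power2_eq_square algebra_simps)
  have t: "((\<lambda>s. cutoff_deriv n ((s\<^sup>2 + x\<^sup>2) / R\<^sup>2) * (2 * x / R\<^sup>2)) has_real_derivative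
      cutoff_deriv2 n ((t\<^sup>2 + x\<^sup>2) / R\<^sup>2) * (2 * t / R\<^sup>2) * (2 * x / R\<^sup>2)) (at t within {0..})" for t x
    by (rule DERIV_cmult_right) (rule DERIV_cutoff_radius(3)[OF assms])
  show "C1_halfplane (\<lambda>t x. cutoff_deriv n ((t\<^sup>2 + x\<^sup>2) / R\<^sup>2) * (2 * x / R\<^sup>2))"
    by (rule C1_halfplaneI, rule t, rule x)
      (auto simp: case_prod_unfold divide_inverse[of _ "R\<^sup>2"] intro!: continuous_intros)
  show "dx (\<lambda>t x. cutoff_deriv n ((t\<^sup>2 + x\<^sup>2) / R\<^sup>2) * (2 * x / R\<^sup>2)) t x
      = cutoff_deriv2 n ((t\<^sup>2 + x\<^sup>2) / R\<^sup>2) * (2 * x / R\<^sup>2)\<^sup>2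
        + cutoff_deriv n ((t\<^sup>2 + x\<^sup>2) / R\<^sup>2) * (2 / R\<^sup>2)" for t x
    using x by (rule dx_eqI)
qed

lemma cutoff_C2:
  assumes "3 \<le> n"
  shows "C2_halfplane (cutoff n R)"
  unfolding C2_halfplane_def
proof (intro conjI)
  show "C1_halfplane (cutoff n R)"
    using assms by (intro cutoff_C1) simp
  show "C1_halfplane (dt (cutoff n R))"
    using cutoff_deriv_t_C1(1)[OF assms]
    by (rule C1_halfplane_cong) (use assms in \<open>simp add: cutoff_dt\<close>)
  show "C1_halfplane (dx (cutoff n R))"
    using cutoff_deriv_x_C1(1)[OF assms]
    by (rule C1_halfplane_cong) (use assms in \<open>simp add: cutoff_dx\<close>)
qed

lemma cutoff_dt_dt:
  assumes "3 \<le> n" "0 \<le> t"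
  shows "dt (dt (cutoff n R)) t x = cutoff_deriv2 n ((t\<^sup>2 + x\<^sup>2) / R\<^sup>2) * (2 * t / R\<^sup>2)\<^sup>2
        + cutoff_deriv n ((t\<^sup>2 + x\<^sup>2) / R\<^sup>2) * (2 / R\<^sup>2)"
  unfolding cutoff_deriv_t_C1(2)[OF assms, symmetric]
  using cutoff_deriv_t_C1(1)[OF assms(1)]
  by (rule dt_cong) (use assms in \<open>simp_all add: cutoff_dt\<close>)

lemma cutoff_dx_dx:
  assumes "3 \<le> n" "0 \<le> t"
  shows "dx (dx (cutoff n R)) t x = cutoff_deriv2 n ((t\<^sup>2 + x\<^sup>2) / R\<^sup>2) * (2 * x / R\<^sup>2)\<^sup>2
        + cutoff_deriv n ((t\<^sup>2 + x\<^sup>2) / R\<^sup>2) * (2 / R\<^sup>2)"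
  unfolding cutoff_deriv_x_C1(2)[OF assms(1), symmetric]
  by (rule dx_cong) (use assms in \<open>simp_all add: cutoff_dx\<close>)

lemma cutoff_pow_radius_eq_0:
  assumes "0 < R" "0 < m" "2 * R\<^sup>2 \<le> t\<^sup>2 + x\<^sup>2"
  shows "cutoff_pow m ((t\<^sup>2 + x\<^sup>2) / R\<^sup>2) = 0"
  using assms by (intro cutoff_pow_eq_0) (simp_all add: field_simps)

text \<open>The factor 3/2 is a rational substitute for the square root of 2.\<close>

lemma cutoff_radius_le:
  fixes t x R :: real
  assumes "0 < R" "t\<^sup>2 + x\<^sup>2 \<le> 2 * R\<^sup>2"
  shows "\<bar>t\<bar> \<le> 3/2 * R" "\<bar>x\<bar> \<le> 3/2 * R"
proof -
  have "(3/2 * R)\<^sup>2 = 9/4 * R\<^sup>2"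
    by (simp add: power_mult_distrib power_divide)
  then have "t\<^sup>2 \<le> (3/2 * R)\<^sup>2" "x\<^sup>2 \<le> (3/2 * R)\<^sup>2"
    using assms(2) zero_le_power2[of x] zero_le_power2[of t] zero_le_power2[of R] by linarith+
  then show "\<bar>t\<bar> \<le> 3/2 * R" "\<bar>x\<bar> \<le> 3/2 * R"
    using assms(1) abs_le_square_iff[of t "3/2 * R"] abs_le_square_iff[of x "3/2 * R"] by simp_all
qed

text \<open>On the support the inner derivative 2 s / R^2 is at most 3 / R, and 45 = 15 * 3. Beyond
  the support both sides are zero.\<close>

lemma cutoff_first_derivs_bound:
  assumes "3 \<le> n" "0 < R" "0 \<le> t"
  shows "\<bar>dt (cutoff n R) t x\<bar> \<le> 45 * (real n)\<^sup>2 / R * cutoff_pow (n - 2) ((t\<^sup>2 + x\<^sup>2) / R\<^sup>2)"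
    "\<bar>dx (cutoff n R) t x\<bar> \<le> 45 * (real n)\<^sup>2 / R * cutoff_pow (n - 2) ((t\<^sup>2 + x\<^sup>2) / R\<^sup>2)"
proof -
  have main: "\<bar>cutoff_deriv n ((t\<^sup>2 + x\<^sup>2) / R\<^sup>2) * (2 * s / R\<^sup>2)\<bar>
      \<le> 45 * (real n)\<^sup>2 / R * cutoff_pow (n - 2) ((t\<^sup>2 + x\<^sup>2) / R\<^sup>2)" if "s = t \<or> s = x" for s
  proof (cases "t\<^sup>2 + x\<^sup>2 \<le> 2 * R\<^sup>2")
    case True
    have "\<bar>2 * s / R\<^sup>2\<bar> \<le> 3 / R"
      using cutoff_radius_le[OF assms(2) True] that assms(2) by (auto simp: field_simps power2_eq_square)
    then have "\<bar>cutoff_deriv n ((t\<^sup>2 + x\<^sup>2) / R\<^sup>2)\<bar> * \<bar>2 * s / R\<^sup>2\<bar>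
       \<le> 15 * (real n)\<^sup>2 * cutoff_pow (n - 2) ((t\<^sup>2 + x\<^sup>2) / R\<^sup>2) * (3 / R)"
      by (intro mult_mono cutoff_deriv_bound assms) (auto simp: cutoff_pow_nonneg)
    then show ?thesis
      by (simp add: abs_mult)
  next
    case False
    then show ?thesis
      using cutoff_deriv_bound[OF assms(1), of "(t\<^sup>2 + x\<^sup>2) / R\<^sup>2"] cutoff_pow_radius_eq_0[of R "n - 2" t x] assms
      by simp
  qed
  show "\<bar>dt (cutoff n R) t x\<bar> \<le> 45 * (real n)\<^sup>2 / R * cutoff_pow (n - 2) ((t\<^sup>2 + x\<^sup>2) / R\<^sup>2)"
    "\<bar>dx (cutoff n R) t x\<bar> \<le> 45 * (real n)\<^sup>2 / R * cutoff_pow (n - 2) ((t\<^sup>2 + x\<^sup>2) / R\<^sup>2)"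
    using main assms by (simp_all add: cutoff_dt cutoff_dx)
qed

text \<open>The chain rule gives the square of the inner derivative, at most 9 / R^2, plus its own
  derivative 2 / R^2; hence 165 = 15 * (9 + 2).\<close>

lemma cutoff_second_derivs_bound:
  assumes "3 \<le> n" "0 < R" "0 \<le> t"
  shows "\<bar>dt (dt (cutoff n R)) t x\<bar> \<le> 165 * (real n)\<^sup>2 / R\<^sup>2 * cutoff_pow (n - 2) ((t\<^sup>2 + x\<^sup>2) / R\<^sup>2)"
    "\<bar>dx (dx (cutoff n R)) t x\<bar> \<le> 165 * (real n)\<^sup>2 / R\<^sup>2 * cutoff_pow (n - 2) ((t\<^sup>2 + x\<^sup>2) / R\<^sup>2)"
proof -
  have main: "\<bar>cutoff_deriv2 n ((t\<^sup>2 + x\<^sup>2) / R\<^sup>2) * (2 * s / R\<^sup>2)\<^sup>2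
        + cutoff_deriv n ((t\<^sup>2 + x\<^sup>2) / R\<^sup>2) * (2 / R\<^sup>2)\<bar>
      \<le> 165 * (real n)\<^sup>2 / R\<^sup>2 * cutoff_pow (n - 2) ((t\<^sup>2 + x\<^sup>2) / R\<^sup>2)" (is "?l \<le> _") if "s = t \<or> s = x" for s
  proof (cases "t\<^sup>2 + x\<^sup>2 \<le> 2 * R\<^sup>2")
    case True
    have "\<bar>2 * s / R\<^sup>2\<bar> \<le> 3 / R"
      using cutoff_radius_le[OF assms(2) True] that assms(2) by (auto simp: field_simps power2_eq_square)
    then have s: "(2 * s / R\<^sup>2)\<^sup>2 \<le> 9 / R\<^sup>2"
      using power_mono[of "\<bar>2 * s / R\<^sup>2\<bar>" "3 / R" 2] by (simp add: power_divide)
    have "?l \<le> \<bar>cutoff_deriv2 n ((t\<^sup>2 + x\<^sup>2) / R\<^sup>2)\<bar> * (2 * s / R\<^sup>2)\<^sup>2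
        + \<bar>cutoff_deriv n ((t\<^sup>2 + x\<^sup>2) / R\<^sup>2)\<bar> * (2 / R\<^sup>2)"
      by (rule order_trans[OF abs_triangle_ineq]) (simp add: abs_mult)
    also have "\<dots> \<le> 15 * (real n)\<^sup>2 * cutoff_pow (n - 2) ((t\<^sup>2 + x\<^sup>2) / R\<^sup>2) * (9 / R\<^sup>2)
        + 15 * (real n)\<^sup>2 * cutoff_pow (n - 2) ((t\<^sup>2 + x\<^sup>2) / R\<^sup>2) * (2 / R\<^sup>2)"
      using s by (intro add_mono mult_mono cutoff_deriv_bound cutoff_deriv2_bound assms)
        (auto simp: cutoff_pow_nonneg)
    finally show ?thesis
      by (simp add: field_simps)
  next
    case False
    then show ?thesis
      using cutoff_deriv_bound[OF assms(1), of "(t\<^sup>2 + x\<^sup>2) / R\<^sup>2"] cutoff_pow_radius_eq_0[of R "n - 2" t x]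
        cutoff_deriv2_bound[OF assms(1), of "(t\<^sup>2 + x\<^sup>2) / R\<^sup>2"] assms
      by simp
  qed
  show "\<bar>dt (dt (cutoff n R)) t x\<bar> \<le> 165 * (real n)\<^sup>2 / R\<^sup>2 * cutoff_pow (n - 2) ((t\<^sup>2 + x\<^sup>2) / R\<^sup>2)"
    "\<bar>dx (dx (cutoff n R)) t x\<bar> \<le> 165 * (real n)\<^sup>2 / R\<^sup>2 * cutoff_pow (n - 2) ((t\<^sup>2 + x\<^sup>2) / R\<^sup>2)"
    using main assms by (simp_all add: cutoff_dt_dt cutoff_dx_dx)
qed

section \<open>Averaging truncated integrals\<close>

lemma integrable_prod_mult:
  fixes a b :: "real \<Rightarrow> real"
  assumes [measurable]: "integrable lborel a" "integrable lborel b"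
  shows "integrable (lborel \<Otimes>\<^sub>M lborel) (\<lambda>(s, x). a s * b x)"
proof (rule lborel_pair.Fubini_integrable)
  show "(\<lambda>(s, x). a s * b x) \<in> borel_measurable (lborel \<Otimes>\<^sub>M lborel)"
    by measurable
  show "integrable lborel (\<lambda>s. LINT x|lborel. norm (case (s, x) of (s, x) \<Rightarrow> a s * b x))"
    using assms by (simp add: abs_mult)
  show "AE s in lborel. integrable lborel (\<lambda>x. case (s, x) of (s, x) \<Rightarrow> a s * b x)"
    using assms by simp
qed

text \<open>
  The cutoff is a superposition of indicators of intervals of half-length between \<open>R\<close> and
  \<open>sqrt 2 * R\<close>; this replaces integrability of \<open>F\<close> by a lower bound for its truncated integrals.
\<close>

lemma cutoff_average:
  fixes F :: "real \<Rightarrow> real"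
  assumes n: "3 \<le> n" and R: "0 < R"
    and F: "\<And>r. integrable lborel (\<lambda>x. indicator {-r..r} x * F x)"
    and [measurable]: "F \<in> borel_measurable borel"
    and lower: "\<And>r. R \<le> r \<Longrightarrow> c \<le> (LINT x|lborel. indicator {-r..r} x * F x)"
  shows "c \<le> (LINT x|lborel. F x * cutoff_pow n (x\<^sup>2 / R\<^sup>2))"
proof -
  \<comment> \<open>The weight is minus the derivative of the cutoff profile on [1, 2]. It is
    nonnegative and has total mass 1, because the profile falls from 1 to 0 there, so it is a
    probability density. Integrating \<open>K\<close> over \<open>x\<close> gives the weighted
    truncated integrals, over \<open>s\<close> the cutoff.\<close>
  define w where "w s = indicator {1..2} s * (- cutoff_deriv n s)" for s :: real
  define K where "K s x = w s * (indicator {-(R * sqrt s)..R * sqrt s} x * F x)" for s x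
  have w_nonneg: "0 \<le> w s" for s
    using cutoff_deriv_nonpos[of n s] by (simp add: w_def indicator_def)
  have FTC: "has_bochner_integral lborel (\<lambda>s. indicator {m..2} s *\<^sub>R (- cutoff_deriv n s)) (cutoff_pow n m)"
    if "m \<le> 2" for m
  proof -
    have "has_bochner_integral lborel (\<lambda>s. indicator {m..2} s *\<^sub>R (- cutoff_deriv n s))
       (- cutoff_pow n 2 - (- cutoff_pow n m))"
      using that n
      by (intro has_bochner_integral_FTC_Icc)
        (auto intro!: DERIV_minus DERIV_subset[OF DERIV_cutoff_pow] continuous_intros
          simp: has_real_derivative_iff_has_vector_derivative[symmetric])
    then show ?thesis
      using n by (simp add: cutoff_pow_eq_0)
  qed
  have w_int: "has_bochner_integral lborel w 1"
    using FTC[of 1] by (simp add: w_def[abs_def] cutoff_pow_eq_1)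
  have [measurable]: "w \<in> borel_measurable borel"
    using w_int by (auto simp: has_bochner_integral_iff)
  have inner_x: "(LINT s|lborel. K s x) = F x * cutoff_pow n (x\<^sup>2 / R\<^sup>2)" for x
  proof -
    define \<sigma> where "\<sigma> = x\<^sup>2 / R\<^sup>2"
    \<comment> \<open>For fixed \<open>x\<close> the condition on the interval becomes a lower limit
      for \<open>s\<close>, so the fundamental theorem of calculus evaluates the integral over
      \<open>s\<close> to the profile at \<open>max 1 \<sigma>\<close>, which is its value at
      \<open>\<sigma>\<close> since the profile is constant up to 1.\<close>
    have iff: "x \<in> {-(R * sqrt s)..R * sqrt s} \<longleftrightarrow> \<sigma> \<le> s" if "1 \<le> s" for s
    proof -
      have "x \<in> {-(R * sqrt s)..R * sqrt s} \<longleftrightarrow> \<bar>x\<bar> \<le> \<bar>R * sqrt s\<bar>"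
        using R that by (auto simp: abs_le_iff abs_mult)
      also have "\<dots> \<longleftrightarrow> x\<^sup>2 \<le> R\<^sup>2 * s"
        using that unfolding abs_le_square_iff by (simp add: power_mult_distrib)
      finally show ?thesis
        using R by (simp add: \<sigma>_def field_simps)
    qed
    have K_eq: "K s x = F x * (indicator {max 1 \<sigma>..2} s *\<^sub>R (- cutoff_deriv n s))" for s
      using iff[of s] by (auto simp: K_def w_def indicator_def)
    show ?thesis
    proof (cases "\<sigma> \<le> 2")
      case True
      then have "(LINT s|lborel. indicator {max 1 \<sigma>..2} s *\<^sub>R (- cutoff_deriv n s)) = cutoff_pow n (max 1 \<sigma>)"
        using FTC[of "max 1 \<sigma>"] by (simp add: has_bochner_integral_iff)
      also have "\<dots> = cutoff_pow n \<sigma>"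
        by (auto simp: max_def cutoff_pow_eq_1)
      finally show ?thesis
        unfolding K_eq \<sigma>_def[symmetric] by (simp only: integral_mult_right_zero)
    next
      case False
      then have "K s x = 0" for s
        unfolding K_eq by (auto simp: indicator_def)
      then show ?thesis
        using False n by (simp add: \<sigma>_def[symmetric] cutoff_pow_eq_0)
    qed
  qed
  have inner_s: "w s * c \<le> (LINT x|lborel. K s x)" for s
  proof (cases "s \<in> {1..2}")
    case True
    have "R * 1 \<le> R * sqrt s"
      using R True by (intro mult_left_mono) auto
    then have "c \<le> (LINT x|lborel. indicator {-(R * sqrt s)..R * sqrt s} x * F x)"
      using lower by simp
    then show ?thesis
      using w_nonneg[of s] by (simp add: K_def mult_left_mono)
  qed (simp add: w_def K_def)
  \<comment> \<open>Since sqrt s \<le> 2 for s in [1, 2], all the moving intervals lie in [-2R, 2R],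
    and \<open>K\<close> is dominated by a product of two integrable functions. Joint measurability
    holds because the moving intervals sweep out a closed set.\<close>
  have K_int: "integrable (lborel \<Otimes>\<^sub>M lborel) (\<lambda>(s, x). K s x)"
  proof (rule Bochner_Integration.integrable_bound[OF integrable_prod_mult[OF _ F]])
    show "integrable lborel w"
      using w_int by (simp add: has_bochner_integral_iff)
    have [measurable]: "{z. snd z \<in> {-(R * sqrt (fst z))..R * sqrt (fst z)}} \<in> sets (lborel \<Otimes>\<^sub>M lborel)"
      unfolding lborel_prod sets_lborel by (intro borel_closed) (auto intro!: closed_Collect_conj closed_Collect_le continuous_intros)
    have "(\<lambda>z. w (fst z) * (indicator {z. snd z \<in> {-(R * sqrt (fst z))..R * sqrt (fst z)}} z * F (snd z)))
      \<in> borel_measurable (lborel \<Otimes>\<^sub>M lborel)"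
      by measurable
    then show "(\<lambda>(s, x). K s x) \<in> borel_measurable (lborel \<Otimes>\<^sub>M lborel)"
      by (simp add: K_def case_prod_unfold indicator_def)
    have "\<bar>K s x\<bar> \<le> \<bar>w s * (indicator {-(2 * R)..2 * R} x * F x)\<bar>" for s x
    proof (cases "s \<in> {1..2}")
      case True
      have "sqrt s \<le> 2"
        using True by (intro real_le_lsqrt) auto
      then have "R * sqrt s \<le> 2 * R"
        using R by simp
      then show ?thesis
        by (auto simp: K_def indicator_def)
    qed (simp add: K_def w_def)
    then show "AE z in lborel \<Otimes>\<^sub>M lborel. norm (case z of (s, x) \<Rightarrow> K s x)
        \<le> norm (case z of (s, x) \<Rightarrow> w s * (indicator {-(2 * R)..2 * R} x * F x))"
      by (auto simp: case_prod_unfold)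
  qed
  have "c = (LINT s|lborel. w s * c)"
    using w_int by (simp add: has_bochner_integral_iff)
  also have "\<dots> \<le> (LINT s|lborel. (LINT x|lborel. K s x))"
    using inner_s w_int lborel_pair.integrable_fst[OF K_int]
    by (intro integral_mono) (auto simp: has_bochner_integral_iff)
  also have "\<dots> = (LINT x|lborel. (LINT s|lborel. K s x))"
    using lborel_pair.Fubini_integral[OF K_int] by simp
  also have "\<dots> = (LINT x|lborel. F x * cutoff_pow n (x\<^sup>2 / R\<^sup>2))"
    unfolding inner_x ..
  finally show ?thesis .
qed

section \<open>Local boundedness of functions in \<open>H\<^sup>1\<close>\<close>

lemma abs_mult_le_sum_squares: "\<bar>a * b\<bar> \<le> a\<^sup>2 + (b::real)\<^sup>2"
proof -
  have "2 * (a * b) \<le> a\<^sup>2 + b\<^sup>2" "- 2 * (a * b) \<le> a\<^sup>2 + b\<^sup>2" "0 \<le> a\<^sup>2 + b\<^sup>2"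
    using sum_squares_bound[of a b] sum_squares_bound[of a "- b"] by simp_all
  then show ?thesis
    by linarith
qed

lemma integrable_mult_L2:
  assumes f: "in_L2 f" and g: "in_L2 g"
  shows "integrable lborel (\<lambda>x. f x * g x)"
proof (rule Bochner_Integration.integrable_bound)
  show "integrable lborel (\<lambda>x. (f x)\<^sup>2 + (g x)\<^sup>2)"
    using f g by (auto simp: in_L2_def)
  show "(\<lambda>x. f x * g x) \<in> borel_measurable lborel"
    using f g by (auto simp: in_L2_def)
  show "AE x in lborel. norm (f x * g x) \<le> norm ((f x)\<^sup>2 + (g x)\<^sup>2)"
    using abs_mult_le_sum_squares by simp
qed

lemma in_L2_diff:
  assumes f: "in_L2 f" and g: "in_L2 g"
  shows "in_L2 (\<lambda>x. f x - g x)"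
proof -
  have "(\<lambda>x. (f x - g x)\<^sup>2) = (\<lambda>x. (f x)\<^sup>2 - 2 * (f x * g x) + (g x)\<^sup>2)"
    by (auto simp: power2_diff)
  moreover have "integrable lborel (\<lambda>x. (f x)\<^sup>2 - 2 * (f x * g x) + (g x)\<^sup>2)"
    using f g integrable_mult_L2[OF f g] by (auto simp: in_L2_def)
  ultimately show ?thesis
    using f g by (auto simp: in_L2_def)
qed

lemma in_L2_continuous:
  fixes g :: "real \<Rightarrow> real"
  assumes "continuous_on UNIV g" and "\<And>x. x \<notin> {a..b} \<Longrightarrow> g x = 0"
  shows "in_L2 g"
proof -
  have "integrable lborel (\<lambda>x. indicator {a..b} x *\<^sub>R (g x)\<^sup>2)"
    using assms(1) by (intro borel_integrable_compact continuous_intros)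
      (auto intro: continuous_on_subset)
  moreover have "(\<lambda>x. indicator {a..b} x *\<^sub>R (g x)\<^sup>2) = (\<lambda>x. (g x)\<^sup>2)"
    using assms(2) by (auto simp: indicator_def fun_eq_iff)
  ultimately show ?thesis
    using assms(1) by (simp add: in_L2_def borel_measurable_continuous_onI)
qed

text \<open>This makes every pairing in the definition of a weak derivative integrable, without
  which additivity of the integral would not be available.\<close>

lemma test_function_in_L2:
  assumes "\<phi> C1_differentiable_on UNIV" and "compact (closure {x. \<phi> x \<noteq> (0::real)})"
  shows "in_L2 \<phi>" "in_L2 (deriv \<phi>)"
proof -
  obtain D where D: "\<And>x. (\<phi> has_real_derivative D x) (at x)" and cont: "continuous_on UNIV D"
    using assms(1) unfolding C1_differentiable_on_def has_real_derivative_iff_has_vector_derivative by auto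
  have \<phi>': "deriv \<phi> = D"
    using D by (auto intro: DERIV_imp_deriv)
  obtain B where B: "\<And>x. \<phi> x \<noteq> 0 \<Longrightarrow> \<bar>x\<bar> \<le> B"
    using bounded_subset[OF compact_imp_bounded[OF assms(2)] closure_subset]
    unfolding bounded_iff by auto
  have 0: "\<phi> x = 0" "D x = 0" if "x \<notin> {-B..B}" for x
  proof -
    have out: "\<phi> y = 0" if "y \<notin> {-B..B}" for y
      using B[of y] that by fastforce
    then show "\<phi> x = 0"
      using that by simp
    have "((\<lambda>_. 0) has_real_derivative 0) (at x)" by simp
    then have "(\<phi> has_real_derivative 0) (at x)"
      by (rule has_field_derivative_transform_within_open[where S = "- {-B..B}"])
        (use that out in \<open>auto simp: open_Compl\<close>)
    then show "D x = 0"
      using D[of x] DERIV_unique by blast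
  qed
  have "continuous_on UNIV \<phi>"
    using D by (meson DERIV_isCont continuous_at_imp_continuous_on)
  then show "in_L2 \<phi>" "in_L2 (deriv \<phi>)"
    using in_L2_continuous[of \<phi> "-B" B] in_L2_continuous[of D "-B" B] 0 cont unfolding \<phi>' by blast+
qed

lemma has_weak_deriv_diff:
  assumes "in_L2 f" "in_L2 f'" "has_weak_deriv f f'" "in_L2 g" "in_L2 g'" "has_weak_deriv g g'"
  shows "has_weak_deriv (\<lambda>x. f x - g x) (\<lambda>x. f' x - g' x)"
  unfolding has_weak_deriv_def
proof (intro allI impI)
  fix \<phi> :: "real \<Rightarrow> real"
  assume \<phi>: "\<phi> C1_differentiable_on UNIV \<and> compact (closure {x. \<phi> x \<noteq> 0})"
  then have L2: "in_L2 \<phi>" "in_L2 (deriv \<phi>)"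
    by (blast intro: test_function_in_L2)+
  have "(LINT x|lborel. f x * deriv \<phi> x) = - (LINT x|lborel. f' x * \<phi> x)"
    "(LINT x|lborel. g x * deriv \<phi> x) = - (LINT x|lborel. g' x * \<phi> x)"
    using assms(3,6) \<phi> unfolding has_weak_deriv_def by blast+
  then show "(LINT x|lborel. (f x - g x) * deriv \<phi> x) = - (LINT x|lborel. (f' x - g' x) * \<phi> x)"
    using integrable_mult_L2[OF assms(1) L2(2)] integrable_mult_L2[OF assms(4) L2(2)]
      integrable_mult_L2[OF assms(2) L2(1)] integrable_mult_L2[OF assms(5) L2(1)]
    by (simp add: left_diff_distrib)
qed

lemma in_H1_diff:
  assumes "in_H1 f" "in_H1 g"
  shows "in_H1 (\<lambda>x. f x - g x)"
proof -
  obtain f' g' where "in_L2 f'" "has_weak_deriv f f'" "in_L2 g'" "has_weak_deriv g g'"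
    using assms unfolding in_H1_def by blast
  then show ?thesis
    using assms in_L2_diff[of f g] in_L2_diff[of f' g'] has_weak_deriv_diff[of f f' g g']
    unfolding in_H1_def by blast
qed

lemma weak_deriv_works:
  assumes "in_H1 f"
  shows "in_L2 (weak_deriv f)" "has_weak_deriv f (weak_deriv f)"
proof -
  have "\<exists>f'. in_L2 f' \<and> has_weak_deriv f f'"
    using assms by (simp add: in_H1_def)
  from someI_ex[OF this] show "in_L2 (weak_deriv f)" "has_weak_deriv f (weak_deriv f)"
    unfolding weak_deriv_def by auto
qed

lemma H1_norm_sq:
  "(H1_norm f)\<^sup>2 = (LINT x|lborel. (f x)\<^sup>2) + (LINT x|lborel. (weak_deriv f x)\<^sup>2)"
  by (simp add: H1_norm_def L2_norm_def)

section \<open>Local sup bounds by duality\<close>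

lemma compactly_supported_antiderivative:
  fixes \<sigma> :: "real \<Rightarrow> real"
  assumes ab: "a < b" and cont: "continuous_on UNIV \<sigma>"
    and supp: "\<And>x. x \<notin> {a..b} \<Longrightarrow> \<sigma> x = 0"
    and zero: "(LINT x|lborel. \<sigma> x) = 0"
  obtains F where "\<And>x. (F has_real_derivative \<sigma> x) (at x)" "\<And>x. x \<notin> {a..b} \<Longrightarrow> F x = 0"
    "\<And>x. \<bar>F x\<bar> \<le> (LINT x|lborel. \<bar>\<sigma> x\<bar>)"
proof -
  have isC: "isCont \<sigma> x" for x
    using cont by (simp add: continuous_on_eq_continuous_at)
  have "(-\<infinity>::ereal) < \<infinity>" by simp
  from einterval_antiderivative[OF this isC]
  obtain F0 where F0: "\<And>x. (F0 has_real_derivative \<sigma> x) (at x)"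
    by (auto simp: has_real_derivative_iff_has_vector_derivative)
  \<comment> \<open>Normalising at \<open>a\<close> makes \<open>F\<close> vanish to the left of the
    interval; the vanishing total integral of \<open>\<sigma>\<close> brings it back to zero at
    \<open>b\<close>, hence on the right as well.\<close>
  define F where "F x = F0 x - F0 a" for x
  have F: "(F has_real_derivative \<sigma> x) (at x within S)" for x S
    unfolding F_def using DERIV_subset[OF F0 subset_UNIV, of x]
    by (auto intro!: derivative_eq_intros)
  have int: "(LINT x|lborel. indicator {c..d} x *\<^sub>R \<sigma> x) = F d - F c"
    if "c \<le> d" for c d
    using that F continuous_on_subset[OF cont subset_UNIV]
    by (intro integral_FTC_Icc) (auto simp: has_real_derivative_iff_has_vector_derivative[symmetric])
  have supp': "indicator {c..d} x *\<^sub>R \<sigma> x = \<sigma> x" if "c \<le> a" "b \<le> d" for c d x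
    using supp that by (cases "x \<in> {c..d}") (auto simp: indicator_def)
  have Fa: "F a = 0" by (simp add: F_def)
  have Fb: "F b = 0"
    using int[of a b] ab zero Fa by (simp add: supp' del: real_scaleR_def)
  have out: "F x = 0" if "x \<notin> {a..b}" for x
  proof (cases "x < a")
    case True
    \<comment> \<open>The support condition says nothing at the endpoint \<open>a\<close> itself,
      which is discarded as a null set.\<close>
    have "indicator {x..a} y *\<^sub>R \<sigma> y = 0 \<or> y = a" for y
      using supp by (auto simp: indicator_def)
    then have "AE y in lborel. indicator {x..a} y *\<^sub>R \<sigma> y = 0"
      using AE_lborel_singleton[of a] by (auto elim!: eventually_mono)
    then have "(LINT y|lborel. indicator {x..a} y *\<^sub>R \<sigma> y) = 0"
      by (rule integral_eq_zero_AE)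
    then show ?thesis
      using int[of x a] True Fa by simp
  next
    case False
    then have "b < x" using that by auto
    have "indicator {b..x} y *\<^sub>R \<sigma> y = 0 \<or> y = b" for y
      using supp by (auto simp: indicator_def)
    then have "AE y in lborel. indicator {b..x} y *\<^sub>R \<sigma> y = 0"
      using AE_lborel_singleton[of b] by (auto elim!: eventually_mono)
    then have "(LINT y|lborel. indicator {b..x} y *\<^sub>R \<sigma> y) = 0"
      by (rule integral_eq_zero_AE)
    then show ?thesis
      using int[of b x] \<open>b < x\<close> Fb by simp
  qed
  have int_abs: "integrable lborel (\<lambda>x. \<bar>\<sigma> x\<bar>)"
  proof -
    have "integrable lborel (\<lambda>x. indicator {a..b} x *\<^sub>R \<bar>\<sigma> x\<bar>)"
      by (intro borel_integrable_compact continuous_intros continuous_on_subset[OF cont]) auto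
    moreover have "(\<lambda>x. indicator {a..b} x *\<^sub>R \<bar>\<sigma> x\<bar>) = (\<lambda>x. \<bar>\<sigma> x\<bar>)"
      using supp by (auto simp: indicator_def fun_eq_iff)
    ultimately show ?thesis by simp
  qed
  have "\<bar>F x\<bar> \<le> (LINT x|lborel. \<bar>\<sigma> x\<bar>)" for x
  proof (cases "x \<in> {a..b}")
    case True
    then have "\<bar>F x\<bar> = \<bar>LINT y|lborel. indicator {a..x} y *\<^sub>R \<sigma> y\<bar>"
      using int[of a x] Fa by simp
    also have "\<dots> \<le> (LINT y|lborel. \<bar>indicator {a..x} y *\<^sub>R \<sigma> y\<bar>)"
      by (rule integral_abs_bound)
    also have "\<dots> \<le> (LINT x|lborel. \<bar>\<sigma> x\<bar>)"
      using cont by (intro integral_mono' int_abs) (auto simp: indicator_def)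
    finally show ?thesis .
  next
    case False
    then show ?thesis using out by simp
  qed
  with F out show ?thesis
    using that by blast
qed

text \<open>
  Subtracting a multiple of a fixed bump from \<open>\<eta>\<close> makes its integral vanish, so that its
  antiderivative is an admissible test function.
\<close>

lemma H1_dual_bound:
  fixes R :: real
  assumes "0 < R"
  obtains C where "0 < C"
    "\<And>f f' \<eta>. in_L2 f \<Longrightarrow> in_L2 f' \<Longrightarrow> has_weak_deriv f f' \<Longrightarrow> continuous_on UNIV \<eta> \<Longrightarrow>
       (\<And>x. 0 \<le> \<eta> x) \<Longrightarrow> (\<And>x. x \<notin> {-R..R} \<Longrightarrow> \<eta> x = 0) \<Longrightarrow>
       (LINT x|lborel. f x * \<eta> x)
         \<le> C * (1 + (LINT x|lborel. (f x)\<^sup>2) + (LINT x|lborel. (f' x)\<^sup>2)) * (LINT x|lborel. \<eta> x)"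
proof -
  define \<rho>0 where "\<rho>0 x = max 0 (R - \<bar>x\<bar>)" for x
  have \<rho>0: "continuous_on UNIV \<rho>0" "\<And>x. 0 \<le> \<rho>0 x" "\<And>x. x \<notin> {-R..R} \<Longrightarrow> \<rho>0 x = 0"
    unfolding \<rho>0_def by (auto intro!: continuous_intros)
  have int_of: "integrable lborel \<eta>" if "continuous_on UNIV \<eta>" "\<And>x. x \<notin> {-R..R} \<Longrightarrow> \<eta> x = 0" for \<eta> :: "real \<Rightarrow> real"
  proof -
    have "integrable lborel (\<lambda>x. indicator {-R..R} x *\<^sub>R \<eta> x)"
      by (intro borel_integrable_compact continuous_on_subset[OF that(1)]) auto
    moreover have "(\<lambda>x. indicator {-R..R} x *\<^sub>R \<eta> x) = \<eta>"
      using that(2) by (auto simp: indicator_def fun_eq_iff)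
    ultimately show ?thesis by simp
  qed
  have \<rho>0_pos: "0 < (LINT x|lborel. \<rho>0 x)"
  proof -
    have "(LINT x|lborel. indicator {-R/2..R/2} x *\<^sub>R (R/2)) \<le> (LINT x|lborel. \<rho>0 x)"
      using assms by (intro integral_mono' int_of \<rho>0) (auto simp: \<rho>0_def indicator_def)
    moreover have "(LINT x|lborel. indicator {-R/2..R/2} x *\<^sub>R (R/2)) = R * R / 2"
      using assms by simp
    moreover have "0 < R * R / 2"
      using assms by simp
    ultimately show ?thesis
      by linarith
  qed
  define \<rho> where "\<rho> x = \<rho>0 x / (LINT x|lborel. \<rho>0 x)" for x
  have \<rho>: "continuous_on UNIV \<rho>" "\<And>x. 0 \<le> \<rho> x" "\<And>x. x \<notin> {-R..R} \<Longrightarrow> \<rho> x = 0" "(LINT x|lborel. \<rho> x) = 1"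
    unfolding \<rho>_def using \<rho>0 \<rho>0_pos by (auto intro!: continuous_intros)
  have \<rho>L2: "in_L2 \<rho>"
    using \<rho> by (intro in_L2_continuous)
  \<comment> \<open>2R comes from integrating the constant 1 over [-R, R] in the estimate of the
    derivative term, the square integral of \<open>\<rho>\<close> from pairing \<open>f\<close> with
    the bump. The 3 is slack that ensures C \<ge> 1, so that the two square integrals can be
    multiplied by \<open>C\<close>.\<close>
  define C where "C = 3 + 2 * R + (LINT x|lborel. (\<rho> x)\<^sup>2)"
  have C: "1 \<le> C"
  proof -
    have "0 \<le> (LINT x|lborel. (\<rho> x)\<^sup>2)"
      by (intro integral_nonneg_AE) auto
    then show ?thesis
      using assms unfolding C_def by linarith
  qed
  then have C0: "0 < C"
    by simp
  show ?thesis
  proof (rule that[OF C0])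
    fix f f' \<eta> :: "real \<Rightarrow> real"
    assume f: "in_L2 f" and f': "in_L2 f'" and w: "has_weak_deriv f f'"
      and \<eta>: "continuous_on UNIV \<eta>" "\<And>x. 0 \<le> \<eta> x" "\<And>x. x \<notin> {-R..R} \<Longrightarrow> \<eta> x = 0"
    define m where "m = (LINT x|lborel. \<eta> x)"
    have m: "0 \<le> m"
      unfolding m_def using \<eta> by (auto intro: integral_nonneg_AE)
    define \<sigma> where "\<sigma> x = \<eta> x - m * \<rho> x" for x
    have \<sigma>: "continuous_on UNIV \<sigma>" "\<And>x. x \<notin> {-R..R} \<Longrightarrow> \<sigma> x = 0"
      unfolding \<sigma>_def using \<eta> \<rho> by (auto intro!: continuous_intros)
    have "(LINT x|lborel. \<sigma> x) = 0"
      unfolding \<sigma>_def using int_of[OF \<eta>(1,3)] int_of[OF \<rho>(1,3)] \<rho>(4) by (simp add: m_def)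
    moreover have "-R < R"
      using assms by simp
    ultimately obtain F where F: "\<And>x. (F has_real_derivative \<sigma> x) (at x)" "\<And>x. x \<notin> {-R..R} \<Longrightarrow> F x = 0"
      "\<And>x. \<bar>F x\<bar> \<le> (LINT x|lborel. \<bar>\<sigma> x\<bar>)"
      using compactly_supported_antiderivative[of "-R" R \<sigma>] \<sigma> by blast
    \<comment> \<open>The bump has unit mass, so subtracting \<open>m\<close> copies of it at most
      doubles the L1 norm. Through the antiderivative this becomes a sup bound on \<open>F\<close>
      that is linear in \<open>m\<close>.\<close>
    have "(LINT x|lborel. \<bar>\<sigma> x\<bar>) \<le> (LINT x|lborel. \<eta> x + m * \<rho> x)"
      using int_of[OF \<eta>(1,3)] int_of[OF \<rho>(1,3)] \<eta>(2) \<rho>(2) m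
      by (intro integral_mono' ) (auto simp: \<sigma>_def abs_le_iff)
    also have "\<dots> = 2 * m"
      using int_of[OF \<eta>(1,3)] int_of[OF \<rho>(1,3)] \<rho>(4) by (simp add: m_def)
    finally have F_le: "\<bar>F x\<bar> \<le> 2 * m" for x
      using F(3)[of x] by simp
    have F_C1: "F C1_differentiable_on UNIV"
      unfolding C1_differentiable_on_def
      using F(1) \<sigma>(1) by (auto simp: has_real_derivative_iff_has_vector_derivative)
    have F_cpt: "compact (closure {x. F x \<noteq> 0})"
    proof -
      have "{x. F x \<noteq> 0} \<subseteq> {-R..R}" using F(2) by blast
      then show ?thesis
        by (meson bounded_closed_interval bounded_subset compact_closure)
    qed
    have "deriv F = \<sigma>"
      using F(1) by (auto intro: DERIV_imp_deriv)
    with w F_C1 F_cpt have eq: "(LINT x|lborel. f x * \<sigma> x) = - (LINT x|lborel. f' x * F x)"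
      unfolding has_weak_deriv_def by auto
    have FL2: "in_L2 F" and \<eta>L2: "in_L2 \<eta>"
      using test_function_in_L2(1)[OF F_C1 F_cpt] in_L2_continuous[OF \<eta>(1,3)] by auto
    have "(LINT x|lborel. f x * \<eta> x) = (LINT x|lborel. f x * \<sigma> x) + m * (LINT x|lborel. f x * \<rho> x)"
      using integrable_mult_L2[OF f \<eta>L2] integrable_mult_L2[OF f \<rho>L2]
      by (simp add: \<sigma>_def right_diff_distrib mult.left_commute[of _ m])
    also have "(LINT x|lborel. f x * \<rho> x) \<le> (LINT x|lborel. (f x)\<^sup>2 + (\<rho> x)\<^sup>2)"
    proof (intro integral_mono)
      show "f x * \<rho> x \<le> (f x)\<^sup>2 + (\<rho> x)\<^sup>2" for x
        using abs_mult_le_sum_squares[of "f x" "\<rho> x"] by linarith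
    qed (use integrable_mult_L2[OF f \<rho>L2] f \<rho>L2 in \<open>auto simp: in_L2_def\<close>)
    also have "\<dots> = (LINT x|lborel. (f x)\<^sup>2) + (LINT x|lborel. (\<rho> x)\<^sup>2)"
      using f \<rho>L2 by (simp add: in_L2_def)
    \<comment> \<open>The weak derivative shifts the pairing to \<open>f'\<close> against
      \<open>F\<close>. From |F| \<le> 2m and 2|f'| \<le> f'^2 + 1 one gets an integrable bound,
      because \<open>F\<close> vanishes off [-R, R] and the constant 1 is only needed there.\<close>
    also have "(LINT x|lborel. f x * \<sigma> x) \<le> m * ((LINT x|lborel. (f' x)\<^sup>2) + 2 * R)"
    proof -
      have "(LINT x|lborel. f x * \<sigma> x) = (LINT x|lborel. - f' x * F x)"
        by (simp add: eq)
      also have "\<dots> \<le> (LINT x|lborel. m * ((f' x)\<^sup>2 + indicator {-R..R} x))"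
      proof (intro integral_mono)
        show "- f' x * F x \<le> m * ((f' x)\<^sup>2 + indicator {-R..R} x)" for x
        proof (cases "x \<in> {-R..R}")
          case True
          have "- f' x * F x \<le> \<bar>f' x\<bar> * \<bar>F x\<bar>"
            by (metis abs_ge_self abs_minus_cancel abs_mult)
          also have "\<dots> \<le> \<bar>f' x\<bar> * (2 * m)"
            by (intro mult_left_mono F_le) simp
          also have "\<dots> = m * (2 * \<bar>f' x\<bar> * 1)" by simp
          also have "\<dots> \<le> m * (\<bar>f' x\<bar>\<^sup>2 + 1\<^sup>2)"
            by (intro mult_left_mono m sum_squares_bound)
          finally show ?thesis using True by simp
        next
          case False
          then show ?thesis using F(2) m by simp
        qed
      next
        show "integrable lborel (\<lambda>x. - f' x * F x)"
          using integrable_mult_L2[OF f' FL2] by simp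
        show "integrable lborel (\<lambda>x. m * ((f' x)\<^sup>2 + indicator {-R..R} x))"
          using f' by (intro integrable_mult_right Bochner_Integration.integrable_add)
            (auto simp: in_L2_def emeasure_lborel_Icc_eq intro!: integrable_real_indicator)
      qed
      also have "\<dots> = m * ((LINT x|lborel. (f' x)\<^sup>2) + 2 * R)"
        using f' assms by (simp add: in_L2_def)
      finally show ?thesis .
    qed
    finally have "(LINT x|lborel. f x * \<eta> x)
      \<le> m * ((LINT x|lborel. (f' x)\<^sup>2) + 2 * R) + m * ((LINT x|lborel. (f x)\<^sup>2) + (LINT x|lborel. (\<rho> x)\<^sup>2))"
      using m by (simp add: mult_left_mono)
    also have "\<dots> = m * ((LINT x|lborel. (f x)\<^sup>2) + (LINT x|lborel. (f' x)\<^sup>2) + (2 * R + (LINT x|lborel. (\<rho> x)\<^sup>2)))"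
      by (simp add: algebra_simps)
    also have "\<dots> \<le> m * (C * (1 + (LINT x|lborel. (f x)\<^sup>2) + (LINT x|lborel. (f' x)\<^sup>2)))"
    proof (rule mult_left_mono[OF _ m])
      have "0 \<le> (LINT x|lborel. (f x)\<^sup>2)" "0 \<le> (LINT x|lborel. (f' x)\<^sup>2)"
        by (auto intro: integral_nonneg_AE)
      then have "(LINT x|lborel. (f x)\<^sup>2) \<le> C * (LINT x|lborel. (f x)\<^sup>2)"
        "(LINT x|lborel. (f' x)\<^sup>2) \<le> C * (LINT x|lborel. (f' x)\<^sup>2)"
        using mult_right_mono[OF C] by fastforce+
      then show "(LINT x|lborel. (f x)\<^sup>2) + (LINT x|lborel. (f' x)\<^sup>2) + (2 * R + (LINT x|lborel. (\<rho> x)\<^sup>2))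
        \<le> C * (1 + (LINT x|lborel. (f x)\<^sup>2) + (LINT x|lborel. (f' x)\<^sup>2))"
        by (simp add: distrib_left) (simp add: C_def)
    qed
    finally show "(LINT x|lborel. f x * \<eta> x)
         \<le> C * (1 + (LINT x|lborel. (f x)\<^sup>2) + (LINT x|lborel. (f' x)\<^sup>2)) * (LINT x|lborel. \<eta> x)"
      by (simp add: m_def mult_ac)
  qed
qed

text \<open>
  The dual bound passes from continuous functions to indicators of compact sets, and every set of
  positive measure contains a compact set of positive measure.
\<close>

lemma AE_le_of_dual_bound:
  fixes f :: "real \<Rightarrow> real"
  assumes f: "in_L2 f"
    and dual: "\<And>\<eta>. continuous_on UNIV \<eta> \<Longrightarrow> (\<And>x. 0 \<le> \<eta> x) \<Longrightarrow>
      (\<And>x. x \<notin> {-(R + 1)..R + 1} \<Longrightarrow> \<eta> x = 0) \<Longrightarrow>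
      (LINT x|lborel. f x * \<eta> x) \<le> M * (LINT x|lborel. \<eta> x)"
  shows "AE x in lborel. \<bar>x\<bar> \<le> R \<longrightarrow> f x \<le> M"
proof -
  have [measurable]: "f \<in> borel_measurable borel"
    using f by (simp add: in_L2_def)
  \<comment> \<open>The empty set is excluded because the distance to it is 0 by convention, which
    would make the approximations below equal to 1 everywhere.\<close>
  have compact_bound: "(LINT x|lborel. f x * indicator K x) \<le> M * measure lborel K"
    if K: "compact K" "K \<noteq> {}" "K \<subseteq> {-R..R}" for K
  proof -
    \<comment> \<open>Continuous functions that tend pointwise to the indicator of \<open>K\<close>.
      The slope is at least 1, so they vanish at distance 1 from \<open>K\<close>; this is the
      reason for the margin in the interval of the dual bound.\<close>
    define \<eta> where "\<eta> n x = max 0 (1 - real (Suc n) * infdist x K)" for n x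
    have cont: "continuous_on UNIV (\<eta> n)" for n
      unfolding \<eta>_def by (intro continuous_intros)
    have nonneg: "0 \<le> \<eta> n x" and le1: "\<eta> n x \<le> 1" for n x
      by (auto simp: \<eta>_def infdist_nonneg)
    have zero: "\<eta> n x = 0" if "x \<notin> {-(R + 1)..R + 1}" for n x
    proof -
      have "1 \<le> dist x y" if "y \<in> K" for y
        using K(3) that \<open>x \<notin> _\<close> by (auto simp: dist_real_def)
      then have "1 \<le> infdist x K"
        using K(2) by (auto simp: infdist_def intro!: cINF_greatest)
      then have "1 \<le> real (Suc n) * infdist x K"
        using mult_mono[of 1 "real (Suc n)" 1 "infdist x K"] by simp
      then show ?thesis
        by (simp add: \<eta>_def)
    qed
    have lim: "(\<lambda>n. \<eta> n x) \<longlonglongrightarrow> indicator K x" for x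
    proof (cases "x \<in> K")
      case True
      then show ?thesis
        by (simp add: \<eta>_def)
    next
      case False
      then have "0 < infdist x K"
        using K by (intro infdist_pos_not_in_closed compact_imp_closed)
      then obtain N where N: "inverse (real (Suc N)) < infdist x K"
        using reals_Archimedean by blast
      have "\<eta> n x = 0" if "N \<le> n" for n
      proof -
        have "1 \<le> real (Suc N) * infdist x K"
          using N by (simp add: field_simps del: of_nat_Suc)
        also have "\<dots> \<le> real (Suc n) * infdist x K"
          using that by (intro mult_right_mono infdist_nonneg) simp
        finally show ?thesis
          by (simp add: \<eta>_def)
      qed
      then have "eventually (\<lambda>n. \<eta> n x = 0) sequentially"
        by (auto simp: eventually_sequentially)
      then show ?thesis
        using False by (simp add: tendsto_eventually)
    qed
    have [measurable]: "\<eta> n \<in> borel_measurable borel" for n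
      using cont by (rule borel_measurable_continuous_onI)
    have [measurable]: "K \<in> sets borel"
      using K(1) by (simp add: borel_compact)
    have le_ind: "\<eta> n x \<le> indicator {-(R + 1)..R + 1} x" for n x
      using zero[of x n] le1[of n x] by (auto simp: indicator_def)
    have indL2: "in_L2 (indicator {-(R + 1)..R + 1})"
    proof -
      have "(\<lambda>x. (indicator {-(R + 1)..R + 1} x)\<^sup>2 :: real) = indicator {-(R + 1)..R + 1}"
        by (auto simp: indicator_def)
      then show ?thesis
        by (simp add: in_L2_def integrable_real_indicator emeasure_lborel_Icc_eq)
    qed
    have 1: "(\<lambda>n. LINT x|lborel. f x * \<eta> n x) \<longlonglongrightarrow> (LINT x|lborel. f x * indicator K x)"
    proof (rule integral_dominated_convergence[where w = "\<lambda>x. \<bar>f x * indicator {-(R + 1)..R + 1} x\<bar>"])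
      show "integrable lborel (\<lambda>x. \<bar>f x * indicator {-(R + 1)..R + 1} x\<bar>)"
        by (intro integrable_abs integrable_mult_L2 f indL2)
      show "AE x in lborel. (\<lambda>n. f x * \<eta> n x) \<longlonglongrightarrow> f x * indicator K x"
        using lim by (auto intro!: tendsto_mult_left)
      show "AE x in lborel. norm (f x * \<eta> n x) \<le> \<bar>f x * indicator {-(R + 1)..R + 1} x\<bar>" for n
        using le_ind nonneg by (auto simp: abs_mult intro!: mult_left_mono)
    qed auto
    have "(\<lambda>n. LINT x|lborel. \<eta> n x) \<longlonglongrightarrow> (LINT x|lborel. indicator K x)"
    proof (rule integral_dominated_convergence[where w = "indicator {-(R + 1)..R + 1}"])
      show "AE x in lborel. (\<lambda>n. \<eta> n x) \<longlonglongrightarrow> indicator K x"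
        using lim by auto
      show "AE x in lborel. norm (\<eta> n x) \<le> indicator {-(R + 1)..R + 1} x" for n
        using le_ind nonneg by auto
    qed (auto simp: emeasure_lborel_Icc_eq intro!: integrable_real_indicator)
    then have 2: "(\<lambda>n. M * (LINT x|lborel. \<eta> n x)) \<longlonglongrightarrow> M * measure lborel K"
      by (intro tendsto_mult_left) simp
    show ?thesis
      using dual[OF cont nonneg zero] by (intro LIMSEQ_le[OF 1 2]) auto
  qed
  define A where "A = {x. \<bar>x\<bar> \<le> R \<and> M < f x}"
  have [measurable]: "A \<in> sets borel"
    unfolding A_def by measurable
  have A_sub: "A \<subseteq> {-R..R}"
    by (auto simp: A_def)
  have "emeasure lborel A = 0"
  proof (rule ccontr)
    assume pos: "emeasure lborel A \<noteq> 0"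
    have A_lm: "A \<in> lmeasurable"
      using A_sub by (intro bounded_set_imp_lmeasurable) (auto intro: bounded_subset[OF bounded_closed_interval])
    have A_eq: "emeasure lborel A = ennreal (measure lebesgue A)"
      using emeasure_eq_ennreal_measure[OF fmeasurableD2[OF A_lm]] by simp
    then have "measure lebesgue A \<noteq> 0"
      using pos by (metis ennreal_0)
    then have "0 < measure lebesgue A"
      using measure_nonneg[of lebesgue A] by linarith
    \<comment> \<open>Inner regularity with the full measure of \<open>A\<close> as tolerance: the
      part left out is strictly smaller than \<open>A\<close>, so \<open>K\<close> has positive
      measure.\<close>
    then obtain K where "closed K" and K: "K \<subseteq> A" "emeasure lebesgue (A - K) < ennreal (measure lebesgue A)"
      using sets_lebesgue_inner_closed[OF fmeasurableD[OF A_lm]] by metis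
    moreover have "bounded K"
      using K(1) A_sub by (blast intro: bounded_subset[OF bounded_closed_interval])
    ultimately have K: "compact K" "K \<subseteq> A" "emeasure lebesgue (A - K) < ennreal (measure lebesgue A)"
      by (simp_all add: compact_eq_bounded_closed)
    have KA[measurable]: "K \<in> sets borel"
      using K(1) by (simp add: borel_compact)
    have K_pos: "emeasure lborel K \<noteq> 0"
    proof
      assume 0: "emeasure lborel K = 0"
      have "A = (A - K) \<union> K"
        using K(2) by blast
      then have "emeasure lborel A \<le> emeasure lborel (A - K) + emeasure lborel K"
        using emeasure_subadditive[of "A - K" lborel K] by simp
      also have "\<dots> < emeasure lborel A"
        using K(3) 0 A_eq by simp
      finally show False
        by simp
    qed
    then have "K \<noteq> {}" by auto
    have K_fin: "emeasure lborel K < \<infinity>"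
      using K(1) emeasure_compact_finite by blast
    have intK: "integrable lborel (indicator K :: real \<Rightarrow> real)"
      using K_fin by simp
    have intfK: "integrable lborel (\<lambda>x. f x * indicator K x)"
    proof -
      have "(\<lambda>x. (indicator K x)\<^sup>2 :: real) = indicator K"
        by (auto simp: indicator_def)
      then show ?thesis
        using intK f by (intro integrable_mult_L2) (auto simp: in_L2_def)
    qed
    \<comment> \<open>On \<open>K\<close> the integrand is strictly positive, yet the compact bound
      makes its integral nonpositive; so \<open>K\<close> must be null.\<close>
    have "(LINT x|lborel. (f x - M) * indicator K x) \<le> 0"
      using compact_bound[OF K(1) \<open>K \<noteq> {}\<close>] K(2) A_sub intfK intK
      by (simp add: left_diff_distrib)
    moreover have nn: "AE x in lborel. 0 \<le> (f x - M) * indicator K x"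
      using K(2) by (intro AE_I2) (auto simp: A_def indicator_def)
    moreover have int: "integrable lborel (\<lambda>x. (f x - M) * indicator K x)"
      using intfK intK by (simp add: left_diff_distrib)
    ultimately have "(LINT x|lborel. (f x - M) * indicator K x) = 0"
      using integral_nonneg_AE[OF nn] by linarith
    then have "AE x in lborel. (f x - M) * indicator K x = 0"
      using integral_nonneg_eq_0_iff_AE[OF int nn] by simp
    then have "AE x in lborel. x \<notin> K"
      using K(2) by (auto elim!: eventually_mono simp: A_def indicator_def)
    then have "K \<in> null_sets lborel"
      by (simp add: AE_iff_null_sets)
    then show False
      using K_pos by auto
  qed
  then have "A \<in> null_sets lborel"
    by auto
  then show ?thesis
    by (rule AE_I') (auto simp: A_def)
qed

text \<open>The one-sided estimate is applied to \<open>f\<close> and to its negative. Elementary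
  inequalities between products and squares make the bound quadratic in the norm instead of linear,
  which suffices for local boundedness.\<close>

lemma H1_local_bound:
  fixes R :: real
  assumes "0 \<le> R"
  obtains C where "0 < C"
    "\<And>f. in_H1 f \<Longrightarrow> AE x in lborel. \<bar>x\<bar> \<le> R \<longrightarrow> \<bar>f x\<bar> \<le> C * (1 + (H1_norm f)\<^sup>2)"
proof -
  have "0 < R + 1"
    using assms by simp
  then show ?thesis
  proof (rule H1_dual_bound)
    fix C :: real
    assume C: "0 < C"
      and dual: "\<And>f f' \<eta>. in_L2 f \<Longrightarrow> in_L2 f' \<Longrightarrow> has_weak_deriv f f' \<Longrightarrow> continuous_on UNIV \<eta> \<Longrightarrow>
        (\<And>x. 0 \<le> \<eta> x) \<Longrightarrow> (\<And>x. x \<notin> {-(R + 1)..R + 1} \<Longrightarrow> \<eta> x = 0) \<Longrightarrow>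
        (LINT x|lborel. f x * \<eta> x)
          \<le> C * (1 + (LINT x|lborel. (f x)\<^sup>2) + (LINT x|lborel. (f' x)\<^sup>2)) * (LINT x|lborel. \<eta> x)"
    show ?thesis
    proof (rule that[OF C])
      fix f assume H1: "in_H1 f"
      then have f: "in_L2 f" by (simp add: in_H1_def)
      note w = weak_deriv_works[OF H1]
      have nf: "in_L2 (\<lambda>x. - f x)" "in_L2 (\<lambda>x. - weak_deriv f x)"
        "has_weak_deriv (\<lambda>x. - f x) (\<lambda>x. - weak_deriv f x)"
        using f w by (simp_all add: in_L2_def has_weak_deriv_def)
      have "AE x in lborel. \<bar>x\<bar> \<le> R \<longrightarrow> f x \<le> C * (1 + (H1_norm f)\<^sup>2)"
        using dual[OF f w] by (intro AE_le_of_dual_bound f) (simp add: H1_norm_sq add.assoc)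
      moreover have "AE x in lborel. \<bar>x\<bar> \<le> R \<longrightarrow> - f x \<le> C * (1 + (H1_norm f)\<^sup>2)"
        using dual[OF nf] by (intro AE_le_of_dual_bound nf) (simp add: H1_norm_sq add.assoc)
      ultimately show "AE x in lborel. \<bar>x\<bar> \<le> R \<longrightarrow> \<bar>f x\<bar> \<le> C * (1 + (H1_norm f)\<^sup>2)"
        by eventually_elim auto
    qed
  qed
qed

section \<open>Space-time integrability\<close>

lemma time_interval_infinity: "time_interval \<infinity> = {0..}"
  by (auto simp: time_interval_def)

text \<open>Continuity in H1 makes \<open>u s - u t\<close> small in norm for s near t, so the local
  bound for this difference adds to the one for \<open>u t\<close>. Compactness of [0, A], in the
  form of Bolzano's principle, turns these local bounds into a single one.\<close>

lemma X_local_bound: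
  assumes X: "in_X \<infinity> u" and "0 \<le> A"
  shows "\<exists>M. \<forall>t\<in>{0..A}. AE x in lborel. \<bar>x\<bar> \<le> A \<longrightarrow> \<bar>u t x\<bar> \<le> M"
proof -
  have H1: "\<And>t. 0 \<le> t \<Longrightarrow> in_H1 (u t)"
    and cont: "\<And>t. 0 \<le> t \<Longrightarrow> ((\<lambda>s. H1_norm (\<lambda>x. u s x - u t x)) \<longlongrightarrow> 0) (at t within {0..})"
    using X by (auto simp: in_X_def norm_continuous_def time_interval_infinity)
  obtain C where C: "0 < C"
    "\<And>f. in_H1 f \<Longrightarrow> AE x in lborel. \<bar>x\<bar> \<le> A \<longrightarrow> \<bar>f x\<bar> \<le> C * (1 + (H1_norm f)\<^sup>2)"
    by (rule H1_local_bound[OF \<open>0 \<le> A\<close>]) (rule that)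
  \<comment> \<open>The guard is needed since the short intervals in Bolzano's principle may reach
    below 0, where nothing is known about \<open>u\<close>.\<close>
  define bdd where "bdd t M \<longleftrightarrow> (0 \<le> t \<longrightarrow> (AE x in lborel. \<bar>x\<bar> \<le> A \<longrightarrow> \<bar>u t x\<bar> \<le> M))" for t M
  have bdd_mono: "bdd t N" if "bdd t M" "M \<le> N" for t M N
    using that unfolding bdd_def by (auto elim!: eventually_mono)
  have "\<exists>M. \<forall>t\<in>{0..A}. bdd t M"
    using \<open>0 \<le> A\<close>
  proof (induction rule: Bolzano)
    case (trans a b c)
    then obtain M N where "\<forall>t\<in>{a..b}. bdd t M" "\<forall>t\<in>{b..c}. bdd t N"
      by blast
    then have "\<forall>t\<in>{a..c}. bdd t (max M N)"
      by (meson atLeastAtMost_iff bdd_mono linear max.cobounded1 max.cobounded2)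
    then show ?case ..
  next
    case (local t)
    have "\<forall>\<^sub>F s in at t within {0..}. dist (H1_norm (\<lambda>x. u s x - u t x)) 0 < 1"
      using cont[OF local(1)] by (rule tendstoD) simp
    then obtain d where d: "0 < d"
      "\<And>s. 0 \<le> s \<Longrightarrow> s \<noteq> t \<Longrightarrow> dist s t < d \<Longrightarrow> \<bar>H1_norm (\<lambda>x. u s x - u t x)\<bar> < 1"
      by (auto simp: eventually_at)
    \<comment> \<open>The extra 2C is the local bound for a difference of norm less than 1. The
      limit gives no information at s = t itself, which is why that case is separate below.\<close>
    define M where "M = C * (1 + (H1_norm (u t))\<^sup>2) + 2 * C"
    have t_bound: "AE x in lborel. \<bar>x\<bar> \<le> A \<longrightarrow> \<bar>u t x\<bar> \<le> C * (1 + (H1_norm (u t))\<^sup>2)"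
      by (intro C(2) H1 local(1))
    have bound: "bdd s M" if "dist s t < d" for s
      unfolding bdd_def
    proof
      assume "0 \<le> s"
      have le: "C * (1 + (H1_norm (\<lambda>x. u s x - u t x))\<^sup>2) \<le> C * 2" if "s \<noteq> t"
      proof -
        have "\<bar>H1_norm (\<lambda>x. u s x - u t x)\<bar> < 1"
          using d(2) \<open>0 \<le> s\<close> \<open>dist s t < d\<close> that by simp
        then have "(H1_norm (\<lambda>x. u s x - u t x))\<^sup>2 \<le> 1"
          by (simp add: abs_square_le_1)
        then show ?thesis
          using C(1) by (intro mult_left_mono) simp_all
      qed
      have "AE x in lborel. \<bar>x\<bar> \<le> A \<longrightarrow> \<bar>u s x - u t x\<bar> \<le> C * (1 + (H1_norm (\<lambda>x. u s x - u t x))\<^sup>2)"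
        by (rule C(2)[OF in_H1_diff[OF H1[OF \<open>0 \<le> s\<close>] H1[OF local(1)]]])
      with t_bound show "AE x in lborel. \<bar>x\<bar> \<le> A \<longrightarrow> \<bar>u s x\<bar> \<le> M"
      proof eventually_elim
        case (elim x)
        show ?case
        proof (cases "s = t")
          case True
          then show ?thesis
            using elim(1) C(1) unfolding M_def by (intro impI) simp
        next
          case False
          show ?thesis
            using elim le[OF False] unfolding M_def by (intro impI) linarith
        qed
      qed
    qed
    have "\<exists>M. \<forall>s\<in>{a..b}. bdd s M" if "a \<le> t \<and> t \<le> b \<and> b - a < d" for a b
      using that by (intro exI[of _ M] ballI impI bound) (auto simp: dist_real_def)
    with d(1) show ?case by (intro exI[of _ d]) simp
  qed
  then show ?thesis by (simp add: bdd_def)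
qed

lemma X_measurable:
  assumes "in_X \<infinity> u"
  shows "(\<lambda>z. indicator ({0..} \<times> UNIV) z * u (fst z) (snd z)) \<in> borel_measurable borel"
  using assms by (simp add: in_X_def time_interval_infinity set_borel_measurable_def case_prod_unfold)

text \<open>A bound on almost every point of each time slice becomes a bound almost everywhere in
  the plane by Fubini. This requires a jointly measurable set, so it is stated first for
  \<open>U\<close>, the restriction of \<open>u\<close> to the half plane.\<close>

lemma X_box_bound:
  assumes X: "in_X \<infinity> u" and "0 \<le> A"
  obtains M where "0 \<le> M"
    "AE z in lborel. z \<in> {0..A} \<times> {-A..A} \<longrightarrow> \<bar>u (fst z) (snd z)\<bar> \<le> M"
proof -
  obtain M where M: "\<And>t. t \<in> {0..A} \<Longrightarrow> AE x in lborel. \<bar>x\<bar> \<le> A \<longrightarrow> \<bar>u t x\<bar> \<le> M"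
    using X_local_bound[OF assms] by blast
  define U where "U z = indicator ({0..} \<times> UNIV) z * u (fst z) (snd z)" for z
  have [measurable]: "U \<in> borel_measurable borel"
    unfolding U_def[abs_def] using X by (rule X_measurable)
  have [measurable]: "{0..A} \<times> {-A..A} \<in> sets (borel :: (real \<times> real) measure)"
    by (intro borel_closed closed_Times) auto
  have "AE z in lborel \<Otimes>\<^sub>M lborel. z \<in> {0..A} \<times> {-A..A} \<longrightarrow> \<bar>U z\<bar> \<le> \<bar>M\<bar>"
  proof (rule lborel_pair.AE_pair_measure)
    show "{z \<in> space (lborel \<Otimes>\<^sub>M lborel). z \<in> {0..A} \<times> {-A..A} \<longrightarrow> \<bar>U z\<bar> \<le> \<bar>M\<bar>} \<in> sets (lborel \<Otimes>\<^sub>M lborel)"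
      unfolding lborel_prod by measurable
    have "AE x in lborel. (t, x) \<in> {0..A} \<times> {-A..A} \<longrightarrow> \<bar>U (t, x)\<bar> \<le> \<bar>M\<bar>" for t
    proof (cases "t \<in> {0..A}")
      case True
      show ?thesis
        using M[OF True] by eventually_elim (auto simp: U_def indicator_def)
    qed auto
    then show "AE t in lborel. AE x in lborel. (t, x) \<in> {0..A} \<times> {-A..A} \<longrightarrow> \<bar>U (t, x)\<bar> \<le> \<bar>M\<bar>"
      by simp
  qed
  then have "AE z in lborel. z \<in> {0..A} \<times> {-A..A} \<longrightarrow> \<bar>u (fst z) (snd z)\<bar> \<le> \<bar>M\<bar>"
    unfolding lborel_prod by eventually_elim (auto simp: U_def)
  then show ?thesis
    by (intro that[of "\<bar>M\<bar>"]) auto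
qed

lemma integrable_box:
  fixes f :: "real \<times> real \<Rightarrow> real"
  assumes "f \<in> borel_measurable borel"
    and "AE z in lborel. \<bar>f z\<bar> \<le> B * indicator ({0..A} \<times> {-A..A}) z"
  shows "integrable lborel f"
proof (rule Bochner_Integration.integrable_bound)
  have box: "{0..A} \<times> {-A..A} = cbox (0, -A) (A, A)"
    by (simp add: cbox_Pair_eq)
  show "integrable lborel (\<lambda>z. B * indicator ({0..A} \<times> {-A..A}) z)"
    unfolding box
    by (intro integrable_mult_right integrable_real_indicator emeasure_lborel_cbox_finite) simp
  show "AE z in lborel. norm (f z) \<le> norm (B * indicator ({0..A} \<times> {-A..A}) z :: real)"
    using assms(2) by eventually_elim simp
qed (use assms in simp)

section \<open>The test function estimate\<close>

lemma powr_decay_le: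
  fixes t k C :: real
  assumes "0 \<le> t" "1 \<le> k" "0 \<le> C"
  shows "C / (1 + t) powr k \<le> C / (1 + t)"
  using assms powr_mono[of 1 k "1 + t"] by (intro divide_left_mono) auto

text \<open>After the product rule, the terms with an undifferentiated cutoff are exactly equation
  (H) times \<open>\<phi>\<close> and cancel.\<close>

lemma adjoint_identity:
  assumes a: "C2_halfplane a" and h: "C2_halfplane h" and H: "equation_H a h"
    and \<phi>: "C2_halfplane \<phi>" and t: "0 \<le> t"
  shows "dt (dt (\<lambda>t x. (1 + h t x) * \<phi> t x)) t x - dx (dx (\<lambda>t x. (1 + h t x) * \<phi> t x)) t x
        - dt (\<lambda>s y. a s y * ((1 + h s y) * \<phi> s y)) t x
      = 2 * (dt h t x * dt \<phi> t x) - 2 * (dx h t x * dx \<phi> t x)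
        + (1 + h t x) * (dt (dt \<phi>) t x - dx (dx \<phi>) t x) - a t x * ((1 + h t x) * dt \<phi> t x)"
proof -
  note g = one_plus_halfplane[OF h]
  note C1 = C2_halfplaneD[OF g(1)] C2_halfplaneD[OF \<phi>] C2_halfplaneD[OF a]
  have "dt (dt h) t x - dx (dx h) t x - a t x * dt h t x - dt a t x * (1 + h t x) = 0"
    using H t unfolding equation_H_def by blast
  then have Hh: "dt (dt h) t x = dx (dx h) t x + a t x * dt h t x + dt a t x * (1 + h t x)"
    by linarith
  have "dt (\<lambda>s y. a s y * ((1 + h s y) * \<phi> s y)) t x
      = dt a t x * ((1 + h t x) * \<phi> t x) + a t x * (dt h t x * \<phi> t x + (1 + h t x) * dt \<phi> t x)"
    by (simp only: dt_mult[OF C1(7) C1_halfplane_mult[OF C1(1,4)] t] dt_mult[OF C1(1,4) t] g(2)[OF t])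
  then show ?thesis
    unfolding dt_dt_mult[OF g(1) \<phi> t] dx_dx_mult[OF g(1) \<phi> t] g(2-)[OF t] Hh
    by (simp add: algebra_simps)
qed

text \<open>
  Only terms carrying a derivative of the cutoff remain, and on its support the factor \<open>1 / R\<close> of
  a second derivative is comparable to \<open>1 / (1 + t)\<close>.
\<close>

lemma adjoint_bound:
  assumes a: "C2_halfplane a" and h: "C2_halfplane h" and H: "equation_H a h"
    and A: "decay_A k \<delta> a" and B: "bound_B \<theta> k h"
    and k: "1 < k" and \<theta>: "\<theta> < 1" and n: "3 \<le> n"
  shows "\<exists>D>0. \<forall>R\<ge>1. \<forall>t\<ge>0. \<forall>x.
      \<bar>dt (dt (\<lambda>t x. (1 + h t x) * cutoff n R t x)) t x - dx (dx (\<lambda>t x. (1 + h t x) * cutoff n R t x)) t x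
        - dt (\<lambda>s y. a s y * ((1 + h s y) * cutoff n R s y)) t x\<bar>
      \<le> D / ((1 + t) * R) * cutoff_pow (n - 2) ((t\<^sup>2 + x\<^sup>2) / R\<^sup>2)"
proof -
  obtain C where C: "0 < C" "\<And>t x. 0 \<le> t \<Longrightarrow> \<bar>h t x\<bar> \<le> \<theta> / (1 + t) powr (k - 1)"
    "\<And>t x. 0 \<le> t \<Longrightarrow> \<bar>dt h t x\<bar> + \<bar>dx h t x\<bar> \<le> C / (1 + t) powr k"
    using B unfolding bound_B_def by blast
  have a_le: "\<bar>a t x\<bar> \<le> \<delta> / (1 + t) powr k" if "0 \<le> t" for t x
    using A[unfolded decay_A_def, rule_format, of 0 0 t x] that by simp
  have "\<bar>a 0 0\<bar> \<le> \<delta>"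
    using a_le[of 0 0] by simp
  then have \<delta>: "0 \<le> \<delta>"
    by linarith
  have "\<bar>h 0 0\<bar> \<le> \<theta>"
    using C(2)[of 0 0] by simp
  then have \<theta>0: "0 \<le> \<theta>"
    by linarith
  \<comment> \<open>180 = 4 * 45 counts the two doubled products of first derivatives, 90 = 2 * 45
    the damping term with g \<le> 2, and 1650 = 4 * 165 * 5/2 the two second derivatives with g
    \<le> 2 after one factor 1 / R is exchanged for 1 / (1 + t).\<close>
  define D where "D = (real n)\<^sup>2 * (180 * C + 1650 + 90 * \<delta>)"
  show ?thesis
  proof (intro exI[of _ D] conjI allI impI)
    show "0 < D"
      using n C(1) \<delta> by (simp add: D_def add_pos_nonneg)
  next
    fix R t x :: real
    assume R: "1 \<le> R" and t: "0 \<le> t"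
    define \<phi> where "\<phi> = cutoff n R"
    define P where "P = cutoff_pow (n - 2) ((t\<^sup>2 + x\<^sup>2) / R\<^sup>2)"
    define X where "X = 45 * (real n)\<^sup>2 / R * P"
    define Y where "Y = 165 * (real n)\<^sup>2 / R\<^sup>2 * P"
    have P: "0 \<le> P" by (simp add: P_def cutoff_pow_nonneg)
    have X: "0 \<le> X" and Y: "0 \<le> Y"
      using P R by (simp_all add: X_def Y_def)
    have h': "\<bar>dt h t x\<bar> \<le> C / (1 + t)" "\<bar>dx h t x\<bar> \<le> C / (1 + t)"
      using C(3)[OF t, of x] powr_decay_le[OF t, of k C] k C(1) by linarith+
    have a': "\<bar>a t x\<bar> \<le> \<delta> / (1 + t)"
      using a_le[OF t, of x] powr_decay_le[OF t, of k \<delta>] k \<delta> by linarith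
    have g: "\<bar>1 + h t x\<bar> \<le> 2"
    proof -
      have "\<theta> / (1 + t) powr (k - 1) \<le> \<theta> / 1"
        using \<theta>0 t k by (intro divide_left_mono) (auto intro: ge_one_powr_ge_zero)
      then show ?thesis
        using C(2)[OF t, of x] \<theta> by simp
    qed
    have R0: "0 < R" using R by simp
    note \<phi>' = cutoff_first_derivs_bound[OF n R0 t, of x, folded \<phi>_def P_def, folded X_def]
      cutoff_second_derivs_bound[OF n R0 t, of x, folded \<phi>_def P_def, folded Y_def]
    have 1: "\<bar>dt h t x * dt \<phi> t x\<bar> \<le> C / (1 + t) * X" "\<bar>dx h t x * dx \<phi> t x\<bar> \<le> C / (1 + t) * X"
      unfolding abs_mult using C(1) t by (intro mult_mono h' \<phi>'; simp)+
    have 2: "\<bar>(1 + h t x) * (dt (dt \<phi>) t x - dx (dx \<phi>) t x)\<bar> \<le> 2 * (2 * Y)"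
    proof -
      have "\<bar>dt (dt \<phi>) t x - dx (dx \<phi>) t x\<bar> \<le> 2 * Y"
        using \<phi>'(3,4) by linarith
      then show ?thesis
        unfolding abs_mult using g by (intro mult_mono) auto
    qed
    have 3: "\<bar>a t x * ((1 + h t x) * dt \<phi> t x)\<bar> \<le> \<delta> / (1 + t) * (2 * X)"
      unfolding abs_mult using \<delta> t by (intro mult_mono a' g \<phi>'; simp)
    \<comment> \<open>On the support t \<le> 3R/2, and R \<ge> 1 gives 1 + t \<le> 5R/2; this is the
      exchange just mentioned.\<close>
    have 4: "4 * Y \<le> 1650 * (real n)\<^sup>2 / ((1 + t) * R) * P"
    proof (cases "t\<^sup>2 + x\<^sup>2 \<le> 2 * R\<^sup>2")
      case True
      have "\<bar>t\<bar> \<le> 3 / 2 * R"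
        using cutoff_radius_le(1)[OF R0 True] .
      then have le: "(1 + t) * R \<le> (5 / 2 * R) * R"
        using R by (intro mult_right_mono) auto
      have "1650 * (real n)\<^sup>2 / ((5 / 2 * R) * R) \<le> 1650 * (real n)\<^sup>2 / ((1 + t) * R)"
        using t R0 by (intro divide_left_mono le) auto
      also have "1650 * (real n)\<^sup>2 / ((5 / 2 * R) * R) = 660 * (real n)\<^sup>2 / R\<^sup>2"
        by (simp add: power2_eq_square)
      finally have "660 * (real n)\<^sup>2 / R\<^sup>2 * P \<le> 1650 * (real n)\<^sup>2 / ((1 + t) * R) * P"
        using P by (rule mult_right_mono)
      then show ?thesis
        by (simp add: Y_def)
    next
      case False
      then have "P = 0"
        using n R0 unfolding P_def by (intro cutoff_pow_radius_eq_0) auto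
      then show ?thesis by (simp add: Y_def)
    qed
    have "\<bar>2 * (dt h t x * dt \<phi> t x) - 2 * (dx h t x * dx \<phi> t x)
        + (1 + h t x) * (dt (dt \<phi>) t x - dx (dx \<phi>) t x) - a t x * ((1 + h t x) * dt \<phi> t x)\<bar>
      \<le> 4 * (C / (1 + t) * X) + 4 * Y + \<delta> / (1 + t) * (2 * X)"
      using 1 2 3 by linarith
    also have "\<dots> \<le> 4 * (C / (1 + t) * X) + 1650 * (real n)\<^sup>2 / ((1 + t) * R) * P + \<delta> / (1 + t) * (2 * X)"
      using 4 by linarith
    also have "\<dots> = D / ((1 + t) * R) * P"
      using t R0 by (simp add: X_def D_def add_divide_distrib distrib_left distrib_right mult_ac)
    finally show "\<bar>dt (dt (\<lambda>t x. (1 + h t x) * cutoff n R t x)) t x - dx (dx (\<lambda>t x. (1 + h t x) * cutoff n R t x)) t x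
        - dt (\<lambda>s y. a s y * ((1 + h s y) * cutoff n R s y)) t x\<bar>
      \<le> D / ((1 + t) * R) * cutoff_pow (n - 2) ((t\<^sup>2 + x\<^sup>2) / R\<^sup>2)"
      unfolding adjoint_identity[OF a h H cutoff_C2[OF n] t] \<phi>_def P_def .
  qed
qed

section \<open>Young's inequality and the integral of the remainder\<close>

lemma Young_eps:
  fixes x b p \<epsilon> :: real
  assumes p: "1 < p" and \<epsilon>: "0 < \<epsilon>" and x: "0 \<le> x" and b: "0 \<le> b"
  shows "x * b \<le> \<epsilon> * x powr p + \<epsilon> powr (- 1 / (p - 1)) * b powr (p / (p - 1))"
proof (cases "x = 0 \<or> b = 0")
  case True
  then show ?thesis
    using \<epsilon> by auto
next
  case False
  then have pos: "0 < x" "0 < b"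
    using x b by auto
  show ?thesis
  \<comment> \<open>At the threshold the product switches from being controlled by the first term
    alone to being controlled by the second alone; no convexity is used.\<close>
  proof (cases "b \<le> \<epsilon> * x powr (p - 1)")
    case True
    have "x * b \<le> x * (\<epsilon> * x powr (p - 1))"
      using True x by (rule mult_left_mono)
    also have "\<dots> = \<epsilon> * x powr p"
      using pos by (simp add: powr_diff)
    finally show ?thesis
      by (simp add: add_increasing2)
  next
    case False
    then have "x powr (p - 1) \<le> b / \<epsilon>"
      using \<epsilon> by (simp add: field_simps)
    then have "(x powr (p - 1)) powr (1 / (p - 1)) \<le> (b / \<epsilon>) powr (1 / (p - 1))"
      using p by (intro powr_mono2) auto
    then have "x \<le> (b / \<epsilon>) powr (1 / (p - 1))"
      using p pos by (simp add: powr_powr)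
    then have "x * b \<le> (b / \<epsilon>) powr (1 / (p - 1)) * b"
      using b by (rule mult_right_mono)
    also have "\<dots> = \<epsilon> powr (- 1 / (p - 1)) * b powr (1 / (p - 1) + 1)"
      using \<epsilon> pos by (simp add: powr_divide powr_add powr_minus_divide)
    also have "1 / (p - 1) + 1 = p / (p - 1)"
      using p by (simp add: field_simps)
    finally show ?thesis
      using \<epsilon> by (simp add: add_increasing)
  qed
qed

text \<open>Since w \<le> 1, the condition on \<open>n\<close> gives w^(n - 2) \<le> w^(n/p).
  Attaching that factor to \<open>v\<close> makes its p-th power contribute exactly w^n. The value w
  = 0 is separate because real powers need a positive base here.\<close>

lemma Young_cutoff:
  fixes v b p \<epsilon> w :: real
  assumes p: "1 < p" and \<epsilon>: "0 < \<epsilon>" and v: "0 \<le> v" and b: "0 \<le> b"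
    and w: "0 \<le> w" "w \<le> 1" and n: "3 \<le> n" "real n / p \<le> real n - 2"
  shows "v * (b * w ^ (n - 2)) \<le> \<epsilon> * (v powr p * w ^ n) + \<epsilon> powr (- 1 / (p - 1)) * b powr (p / (p - 1))"
proof (cases "w = 0")
  case True
  then show ?thesis
    using n \<epsilon> by (simp add: power_0_left)
next
  case False
  then have w0: "0 < w"
    using w by simp
  have "w ^ (n - 2) = w powr (real n - 2)"
    using w0 n by (simp add: powr_realpow[symmetric] of_nat_diff)
  also have "\<dots> \<le> w powr (real n / p)"
    using w w0 n(2) by (intro powr_mono') auto
  finally have "v * (b * w ^ (n - 2)) \<le> v * (b * w powr (real n / p))"
    using v b by (intro mult_left_mono)
  also have "\<dots> = (v * w powr (real n / p)) * b"
    by simp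
  also have "\<dots> \<le> \<epsilon> * (v * w powr (real n / p)) powr p + \<epsilon> powr (- 1 / (p - 1)) * b powr (p / (p - 1))"
    using v by (intro Young_eps p \<epsilon> b) simp
  also have "(v * w powr (real n / p)) powr p = v powr p * w ^ n"
    using v w0 p by (simp add: powr_mult powr_powr powr_realpow)
  finally show ?thesis .
qed

text \<open>The time factor is at most 1 / (q - 1) uniformly in \<open>A\<close>, because q > 1;
  only the width 2A of the box grows.\<close>

lemma box_integral_bound:
  fixes q A :: real
  assumes q: "1 < q" and A: "0 \<le> A"
  shows "integrable lborel (\<lambda>z. indicator ({0..A} \<times> {-A..A}) z * (1 + fst z) powr (- q))"
    and "(LINT z|lborel. indicator ({0..A} \<times> {-A..A}) z * (1 + fst z) powr (- q)) \<le> 2 * A / (q - 1)"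
proof -
  define f where "f t = indicator {0..A} t *\<^sub>R (1 + t) powr (- q)" for t :: real
  have f: "has_bochner_integral lborel f ((1 + A) powr (1 - q) / (1 - q) - (1 + 0) powr (1 - q) / (1 - q))"
    unfolding f_def[abs_def]
  proof (rule has_bochner_integral_FTC_Icc)
    show "((\<lambda>t. (1 + t) powr (1 - q) / (1 - q)) has_vector_derivative (1 + t) powr (- q)) (at t within {0..A})"
      if "0 \<le> t" "t \<le> A" for t
    proof -
      have "((\<lambda>t. (1 + t) powr (1 - q)) has_real_derivative (1 - q) * (1 + t) powr (- q)) (at t within {0..A})"
        using that by (auto intro!: derivative_eq_intros)
      from DERIV_cdivide[OF this, of "1 - q"] show ?thesis
        using q by (simp add: has_real_derivative_iff_has_vector_derivative)
    qed
  qed (use A in \<open>auto intro!: continuous_intros\<close>)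
  have f_le: "(LINT t|lborel. f t) \<le> 1 / (q - 1)"
  proof -
    have "(1 + A) powr (1 - q) / (1 - q) \<le> 0"
      using q by (intro divide_nonneg_neg) auto
    then have "(LINT t|lborel. f t) \<le> - (1 / (1 - q))"
      using f by (simp add: has_bochner_integral_iff)
    then show ?thesis
      using q by (simp add: minus_divide_right)
  qed
  have f_int: "integrable lborel f"
    using f by (simp add: has_bochner_integral_iff)
  have ind: "integrable lborel (indicator {-A..A} :: real \<Rightarrow> real)"
    by (intro integrable_real_indicator) (auto simp: emeasure_lborel_Icc_eq)
  have int: "integrable (lborel \<Otimes>\<^sub>M lborel) (\<lambda>(t, x). f t * indicator {-A..A} x)"
    by (rule integrable_prod_mult[OF f_int ind])
  have eq: "(\<lambda>z. indicator ({0..A} \<times> {-A..A}) z * (1 + fst z) powr (- q)) = (\<lambda>(t, x). f t * indicator {-A..A} x)"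
    by (auto simp: f_def indicator_def)
  show "integrable lborel (\<lambda>z. indicator ({0..A} \<times> {-A..A}) z * (1 + fst z) powr (- q))"
    using int unfolding eq lborel_prod .
  have "(LINT z|lborel. indicator ({0..A} \<times> {-A..A}) z * (1 + fst z) powr (- q))
    = (LINT t|lborel. (LINT x|lborel. f t * indicator {-A..A} x))"
    unfolding eq using lborel_pair.integral_fst[OF int] by (simp add: lborel_prod)
  also have "\<dots> = (LINT t|lborel. f t) * (2 * A)"
    using A by simp
  also have "\<dots> \<le> 1 / (q - 1) * (2 * A)"
    using A by (intro mult_right_mono f_le) simp
  finally show "(LINT z|lborel. indicator ({0..A} \<times> {-A..A}) z * (1 + fst z) powr (- q)) \<le> 2 * A / (q - 1)"
    by simp
qed

section \<open>Admissibility of the weighted cutoff and measurability\<close>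

lemma integrable_local_mult:
  assumes c: "continuous_on UNIV c" and f: "in_L2 f"
  shows "integrable lborel (\<lambda>x. indicator {-r..r} x * (c x * f x))"
proof -
  have "integrable lborel (\<lambda>x. indicator {-r..r} x *\<^sub>R (c x)\<^sup>2)"
    by (intro borel_integrable_compact continuous_intros continuous_on_subset[OF c]) auto
  moreover have "(\<lambda>x. (indicator {-r..r} x * c x)\<^sup>2) = (\<lambda>x. indicator {-r..r} x *\<^sub>R (c x)\<^sup>2)"
    by (auto simp: indicator_def)
  ultimately have "in_L2 (\<lambda>x. indicator {-r..r} x * c x)"
    using borel_measurable_continuous_onI[OF c] by (simp add: in_L2_def)
  from integrable_mult_L2[OF this f] show ?thesis
    by (simp add: mult.assoc)
qed

lemma weighted_cutoff_test_function:
  assumes g: "C2_halfplane g" and n: "3 \<le> n" and R: "0 < R"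
  shows "test_function \<infinity> (\<lambda>t x. g t x * cutoff n R t x)"
proof -
  have "{(t, x). 0 \<le> t \<and> g t x * cutoff n R t x \<noteq> 0} \<subseteq> {0..2 * R} \<times> {-2 * R..2 * R}"
  proof clarify
    fix t x
    assume t: "0 \<le> t" and "g t x * cutoff n R t x \<noteq> 0"
    then have "\<not> 2 * R\<^sup>2 \<le> t\<^sup>2 + x\<^sup>2"
      using cutoff_pow_radius_eq_0[OF R, of n t x] n by (auto simp: cutoff_def)
    then have "\<bar>t\<bar> \<le> 3/2 * R" "\<bar>x\<bar> \<le> 3/2 * R"
      using cutoff_radius_le[OF R, of t x] by auto
    then show "t \<in> {0..2 * R} \<and> x \<in> {-2 * R..2 * R}"
      using t R by (auto simp: abs_le_iff)
  qed
  then have sub: "closure {(t, x). 0 \<le> t \<and> g t x * cutoff n R t x \<noteq> 0} \<subseteq> {0..2 * R} \<times> {-2 * R..2 * R}"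
    by (intro closure_minimal closed_Times) auto
  have "bounded ({0..2 * R} \<times> {-2 * R..2 * R})"
    by (intro bounded_Times) auto
  then have "compact (closure {(t, x). 0 \<le> t \<and> g t x * cutoff n R t x \<noteq> 0})"
    using sub by (meson bounded_subset closed_closure compact_eq_bounded_closed)
  then show ?thesis
    using sub C2_halfplane_mult[OF g cutoff_C2[OF n]]
    by (auto simp: test_function_def time_interval_infinity)
qed

lemma borel_measurable_on_halfplane:
  fixes f :: "real \<times> real \<Rightarrow> real"
  assumes "continuous_on ({0..} \<times> UNIV) f"
  shows "(\<lambda>z. indicator ({0..} \<times> UNIV) z * f z) \<in> borel_measurable borel"
  using borel_measurable_continuous_on_indicator[OF _ assms]
  by (simp add: borel_closed closed_Times)

text \<open>The weak formulation expresses the data functional as the integral of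
  \<open>f1 - f2\<close> (linear minus nonlinear term). Young's inequality with epsilon = 1 - theta
  bounds this difference pointwise by the remainder, since \<open>g\<close> is at least 1 - theta.
  \<open>E\<close> does not depend on \<open>R\<close>.\<close>

lemma data_functional_bound:
  assumes p: "1 < p" and \<theta>: "0 < \<theta>" "\<theta> < 1" and k: "1 < k"
    and a: "C2_halfplane a" and h: "C2_halfplane h" and H: "equation_H a h"
    and A: "decay_A k \<delta> a" and B: "bound_B \<theta> k h"
    and n: "3 \<le> n" "real n / p \<le> real n - 2"
    and sol: "solution_on p a u0 u1 \<infinity> u"
  shows "\<exists>E. \<forall>R\<ge>1.
    (LINT x|lborel. ((- dt h 0 x + (1 + h 0 x) * a 0 x) * u0 x + (1 + h 0 x) * u1 x) * cutoff_pow n (x\<^sup>2 / R\<^sup>2))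
      \<le> E * R powr (1 - p / (p - 1))"
proof -
  define q where "q = p / (p - 1)"
  have q: "1 < q"
    using p by (simp add: q_def)
  define g where "g t x = 1 + h t x" for t x
  have g_C2: "C2_halfplane g"
    using one_plus_halfplane(1)[OF h] unfolding g_def[abs_def] .
  have g_bounds: "1 - \<theta> \<le> g t x" "g t x \<le> 2" if "0 \<le> t" for t x
  proof -
    have "\<bar>h t x\<bar> \<le> \<theta> / (1 + t) powr (k - 1)"
      using B that unfolding bound_B_def by blast
    moreover have "\<theta> / (1 + t) powr (k - 1) \<le> \<theta> / 1"
      using \<theta> that k by (intro divide_left_mono) (auto intro: ge_one_powr_ge_zero)
    ultimately show "1 - \<theta> \<le> g t x" "g t x \<le> 2"
      using \<theta> by (auto simp: g_def)
  qed
  have "\<exists>D>0. \<forall>R\<ge>1. \<forall>t\<ge>0. \<forall>x.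
      \<bar>dt (dt (\<lambda>t x. g t x * cutoff n R t x)) t x - dx (dx (\<lambda>t x. g t x * cutoff n R t x)) t x
        - dt (\<lambda>s y. a s y * (g s y * cutoff n R s y)) t x\<bar>
      \<le> D / ((1 + t) * R) * cutoff_pow (n - 2) ((t\<^sup>2 + x\<^sup>2) / R\<^sup>2)"
    unfolding g_def by (rule adjoint_bound[OF a h H A B k \<theta>(2) n(1)])
  then obtain D where D: "0 < D" "\<forall>R\<ge>1. \<forall>t\<ge>0. \<forall>x.
      \<bar>dt (dt (\<lambda>t x. g t x * cutoff n R t x)) t x - dx (dx (\<lambda>t x. g t x * cutoff n R t x)) t x
        - dt (\<lambda>s y. a s y * (g s y * cutoff n R s y)) t x\<bar>
      \<le> D / ((1 + t) * R) * cutoff_pow (n - 2) ((t\<^sup>2 + x\<^sup>2) / R\<^sup>2)"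
    by (elim exE conjE)
  have X: "in_X \<infinity> u"
    using sol by (simp add: solution_on_def)
  \<comment> \<open>Young's constant for epsilon = 1 - theta, with the factor
    \<open>D powr q\<close> taken out of the \<open>q\<close>-th power of the coefficient.\<close>
  define c where "c = (1 - \<theta>) powr (- 1 / (p - 1)) * D powr q"
  have c: "0 \<le> c" by (simp add: c_def)
  have "(LINT x|lborel. ((- dt h 0 x + (1 + h 0 x) * a 0 x) * u0 x + (1 + h 0 x) * u1 x) * cutoff_pow n (x\<^sup>2 / R\<^sup>2))
      \<le> (c * (4 / (q - 1))) * R powr (1 - q)" if R: "1 \<le> R" for R
  proof -
    define S where "S = {0::real..} \<times> (UNIV :: real set)"
    define box where "box = {0..2 * R} \<times> {-(2 * R)..2 * R}"
    define \<psi> where "\<psi> t x = g t x * cutoff n R t x" for t x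
    define L where "L t x = dt (dt \<psi>) t x - dx (dx \<psi>) t x - dt (\<lambda>s y. a s y * \<psi> s y) t x" for t x
    define P where "P t x = cutoff_pow (n - 2) ((t\<^sup>2 + x\<^sup>2) / R\<^sup>2)" for t x
    have R0: "0 < R" using R by simp
    have P01: "0 \<le> P t x" "P t x \<le> 1" for t x
      by (simp_all add: P_def cutoff_pow_nonneg cutoff_pow_le_1)
    have L_le: "\<bar>L t x\<bar> \<le> D / ((1 + t) * R) * P t x" if "0 \<le> t" for t x
      using D(2)[rule_format, OF R that, of x] unfolding L_def \<psi>_def[abs_def] P_def .
    have outside: "\<psi> t x = 0 \<and> P t x = 0" if "0 \<le> t" "(t, x) \<notin> box" for t x
    proof -
      have "2 * R\<^sup>2 \<le> t\<^sup>2 + x\<^sup>2"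
      proof (rule ccontr)
        assume "\<not> ?thesis"
        then have "\<bar>t\<bar> \<le> 3/2 * R" "\<bar>x\<bar> \<le> 3/2 * R"
          using cutoff_radius_le[OF R0, of t x] by auto
        then have "(t, x) \<in> box"
          using that(1) R by (auto simp: box_def abs_le_iff)
        with that(2) show False ..
      qed
      then show ?thesis
        using cutoff_pow_radius_eq_0[OF R0, of n t x] cutoff_pow_radius_eq_0[OF R0, of "n - 2" t x] n
        by (simp add: \<psi>_def P_def cutoff_def)
    qed
    have test: "test_function \<infinity> \<psi>"
      unfolding \<psi>_def[abs_def] by (rule weighted_cutoff_test_function[OF g_C2 n(1) R0])
    define f1 where "f1 z = indicator S z * (u (fst z) (snd z) * L (fst z) (snd z))" for z
    define f2 where "f2 z = indicator S z * (\<bar>u (fst z) (snd z)\<bar> powr p * \<psi> (fst z) (snd z))" for z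
    have weak: "(LINT z|lborel. f1 z)
        = (LINT x|lborel. (a 0 x * u0 x + u1 x) * \<psi> 0 x - u0 x * dt \<psi> 0 x) + (LINT z|lborel. f2 z)"
    proof -
      have "(LINT (t, x):S|lborel. u t x * L t x)
        = (LINT x|lborel. (a 0 x * u0 x + u1 x) * \<psi> 0 x - u0 x * dt \<psi> 0 x)
          + (LINT (t, x):S|lborel. \<bar>u t x\<bar> powr p * \<psi> t x)"
        using sol test unfolding solution_on_def L_def S_def time_interval_infinity by blast
      then show ?thesis
        by (simp add: set_lebesgue_integral_def f1_def[abs_def] f2_def[abs_def] case_prod_unfold)
    qed
    have \<psi>_C2: "C2_halfplane \<psi>"
      unfolding \<psi>_def[abs_def] by (rule C2_halfplane_mult[OF g_C2 cutoff_C2[OF n(1)]])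
    note C1 = C2_halfplaneD[OF \<psi>_C2] C2_halfplaneD[OF a]
    have U[measurable]: "(\<lambda>z. indicator S z * u (fst z) (snd z)) \<in> borel_measurable borel"
      unfolding S_def by (rule X_measurable[OF X])
    have "continuous_on S (\<lambda>z. L (fst z) (snd z))"
      unfolding L_def S_def
      by (intro continuous_intros C1_halfplane_continuous[OF C1(2)] C1_halfplane_continuous[OF C1(3)]
          C1_halfplane_continuous[OF C1_halfplane_mult[OF C1(4,1)]])
    then have L_meas[measurable]: "(\<lambda>z. indicator S z * L (fst z) (snd z)) \<in> borel_measurable borel"
      unfolding S_def by (rule borel_measurable_on_halfplane)
    have \<psi>_meas[measurable]: "(\<lambda>z. indicator S z * \<psi> (fst z) (snd z)) \<in> borel_measurable borel"
      unfolding S_def by (rule borel_measurable_on_halfplane[OF C1_halfplane_continuous(1)[OF C1(1)]])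
    \<comment> \<open>Only the restriction of \<open>u\<close> to the half plane is known to be
      measurable, so the indicator is attached to each factor.\<close>
    have f1_eq: "f1 z = (indicator S z * u (fst z) (snd z)) * (indicator S z * L (fst z) (snd z))" for z
      by (auto simp: f1_def indicator_def)
    have f2_eq: "f2 z = \<bar>indicator S z * u (fst z) (snd z)\<bar> powr p * (indicator S z * \<psi> (fst z) (snd z))" for z
      by (auto simp: f2_def indicator_def)
    obtain M where M: "0 \<le> M" "AE z in lborel. z \<in> {0..2 * R} \<times> {-(2 * R)..2 * R} \<longrightarrow> \<bar>u (fst z) (snd z)\<bar> \<le> M"
    proof (rule X_box_bound[OF X])
      show "0 \<le> 2 * R" using R0 by simp
    qed (rule that)
    have L_D: "\<bar>L t x\<bar> \<le> D" if "0 \<le> t" for t x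
    proof -
      have "1 * 1 \<le> (1 + t) * R"
        using that R by (intro mult_mono) auto
      then have "D / ((1 + t) * R) \<le> D / 1"
        using D(1) by (intro divide_left_mono) auto
      then have "D / ((1 + t) * R) * P t x \<le> D * 1"
        using D(1) P01 by (intro mult_mono) auto
      then show ?thesis
        using L_le[OF that, of x] by simp
    qed
    \<comment> \<open>Both integrals in the weak formulation have to be finite before they can be
      combined into one; the sup bound on \<open>u\<close> over the box is used for this
      alone.\<close>
    have f1_int: "integrable lborel f1"
    proof (rule integrable_box)
      show "f1 \<in> borel_measurable borel"
        unfolding f1_eq[abs_def] by measurable
      show "AE z in lborel. \<bar>f1 z\<bar> \<le> M * D * indicator ({0..2 * R} \<times> {-(2 * R)..2 * R}) z"
        using M(2)
      proof eventually_elim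
        case (elim z)
        obtain t x where z: "z = (t, x)" by (cases z)
        show ?case
        proof (cases "z \<in> box")
          case True
          then have "\<bar>u t x\<bar> * \<bar>L t x\<bar> \<le> M * D"
            using elim M(1) L_D[of t x] unfolding z box_def by (intro mult_mono) auto
          then show ?thesis
            using True by (auto simp: f1_def z box_def S_def abs_mult)
        next
          case False
          have "f1 z = 0"
          proof (cases "0 \<le> t")
            case True
            then show ?thesis
              using L_le[OF True, of x] outside[OF True, of x] False by (simp add: f1_def z)
          qed (simp add: f1_def z S_def)
          then show ?thesis
            using False by (simp add: box_def)
        qed
      qed
    qed
    have f2_int: "integrable lborel f2"
    proof (rule integrable_box)
      show "f2 \<in> borel_measurable borel"
        unfolding f2_eq[abs_def] by measurable
      show "AE z in lborel. \<bar>f2 z\<bar> \<le> M powr p * 2 * indicator ({0..2 * R} \<times> {-(2 * R)..2 * R}) z"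
        using M(2)
      proof eventually_elim
        case (elim z)
        obtain t x where z: "z = (t, x)" by (cases z)
        show ?case
        proof (cases "z \<in> box")
          case True
          then have t: "0 \<le> t" by (simp add: z box_def)
          have "\<bar>\<psi> t x\<bar> \<le> 2 * 1"
            unfolding \<psi>_def abs_mult using g_bounds[OF t, of x] \<theta>
            by (intro mult_mono) (auto simp: cutoff_def cutoff_pow_nonneg cutoff_pow_le_1)
          moreover have "\<bar>u t x\<bar> powr p \<le> M powr p"
            using elim True p by (intro powr_mono2) (auto simp: z box_def)
          ultimately have "\<bar>u t x\<bar> powr p * \<bar>\<psi> t x\<bar> \<le> M powr p * 2"
            by (intro mult_mono) auto
          then show ?thesis
            using True by (auto simp: f2_def z box_def S_def abs_mult)
        next
          case False
          have "f2 z = 0"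
          proof (cases "0 \<le> t")
            case True
            then show ?thesis
              using outside[OF True, of x] False by (simp add: f2_def z)
          qed (simp add: f2_def z S_def)
          then show ?thesis
            using False by (simp add: box_def)
        qed
      qed
    qed
    have pointwise: "f1 z - f2 z \<le> (c * R powr (- q)) * (indicator box z * (1 + fst z) powr (- q))" for z
    proof -
      obtain t x where z: "z = (t, x)" by (cases z)
      show ?thesis
      proof (cases "0 \<le> t \<and> z \<in> box")
        case True
        then have t: "0 \<le> t" by simp
        define w where "w = max 0 (cutoff_base ((t\<^sup>2 + x\<^sup>2) / R\<^sup>2))"
        have w: "0 \<le> w" "w \<le> 1"
          using cutoff_base_le_1 by (auto simp: w_def)
        have Pw: "P t x = w ^ (n - 2)" and \<phi>w: "cutoff n R t x = w ^ n"
          by (simp_all add: P_def cutoff_def cutoff_pow_def w_def)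
        have "u t x * L t x \<le> \<bar>u t x\<bar> * \<bar>L t x\<bar>"
          by (metis abs_ge_self abs_mult)
        also have "\<dots> \<le> \<bar>u t x\<bar> * (D / ((1 + t) * R) * w ^ (n - 2))"
          using L_le[OF t, of x] by (intro mult_left_mono) (simp_all add: Pw)
        also have "\<dots> \<le> (1 - \<theta>) * (\<bar>u t x\<bar> powr p * w ^ n)
            + (1 - \<theta>) powr (- 1 / (p - 1)) * (D / ((1 + t) * R)) powr (p / (p - 1))"
          using \<theta> D(1) t R0 w n by (intro Young_cutoff p) auto
        also have "(1 - \<theta>) powr (- 1 / (p - 1)) * (D / ((1 + t) * R)) powr (p / (p - 1))
            = (c * R powr (- q)) * (1 + t) powr (- q)"
        proof -
          have "(D / ((1 + t) * R)) powr q = D powr q * ((1 + t) powr (- q) * R powr (- q))"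
            using D(1) t R0 by (simp add: powr_divide powr_mult powr_minus_divide)
          then show ?thesis
            by (simp add: c_def q_def[symmetric] mult_ac)
        qed
        also have "(1 - \<theta>) * (\<bar>u t x\<bar> powr p * w ^ n) \<le> \<bar>u t x\<bar> powr p * \<psi> t x"
        proof -
          have "(1 - \<theta>) * (\<bar>u t x\<bar> powr p * w ^ n) \<le> g t x * (\<bar>u t x\<bar> powr p * w ^ n)"
            using g_bounds(1)[OF t, of x] w by (intro mult_right_mono) auto
          then show ?thesis
            by (simp add: \<psi>_def \<phi>w mult_ac)
        qed
        finally show ?thesis
          using True by (simp add: f1_def f2_def z S_def)
      next
        case False
        have "f1 z = 0 \<and> f2 z = 0"
        proof (cases "0 \<le> t")
          case True
          then show ?thesis
            using L_le[OF True, of x] outside[OF True, of x] False by (simp add: f1_def f2_def z)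
        qed (simp add: f1_def f2_def z S_def)
        then show ?thesis
          using c by simp
      qed
    qed
    have "(LINT x|lborel. (a 0 x * u0 x + u1 x) * \<psi> 0 x - u0 x * dt \<psi> 0 x) = (LINT z|lborel. f1 z - f2 z)"
      using weak f1_int f2_int by simp
    also have "\<dots> \<le> (LINT z|lborel. (c * R powr (- q)) * (indicator box z * (1 + fst z) powr (- q)))"
      using pointwise f1_int f2_int box_integral_bound(1)[OF q, of "2 * R"] R0
      by (intro integral_mono) (auto simp: box_def)
    \<comment> \<open>The box has A = 2R, so its bound 2A / (q - 1) yields the factor 4R / (q - 1)
      and with it the exponent 1 - q.\<close>
    also have "\<dots> \<le> (c * R powr (- q)) * (2 * (2 * R) / (q - 1))"
      using box_integral_bound(2)[OF q, of "2 * R"] R0 c unfolding box_def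
      by (simp only: integral_mult_right_zero) (intro mult_left_mono, auto)
    also have "\<dots> = (c * (4 / (q - 1))) * R powr (1 - q)"
      using R0 by (simp add: powr_diff powr_minus field_simps)
    \<comment> \<open>At t = 0 the cutoff contributes no time derivative, as it depends on
      \<open>t\<close> through its square; regrouping leaves the data density times the
      cutoff.\<close>
    also have "(\<lambda>x. (a 0 x * u0 x + u1 x) * \<psi> 0 x - u0 x * dt \<psi> 0 x)
        = (\<lambda>x. ((- dt h 0 x + (1 + h 0 x) * a 0 x) * u0 x + (1 + h 0 x) * u1 x) * cutoff_pow n (x\<^sup>2 / R\<^sup>2))"
    proof
      fix x
      have n2: "2 \<le> n" using n by simp
      have "dt \<psi> 0 x = dt g 0 x * cutoff n R 0 x + g 0 x * dt (cutoff n R) 0 x"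
        unfolding \<psi>_def[abs_def]
        by (rule dt_mult) (use C2_halfplaneD(1)[OF g_C2] cutoff_C1[OF n2] in auto)
      also have "dt (cutoff n R) 0 x = 0"
        using cutoff_dt[OF n2, of 0] by simp
      also have "dt g 0 x = dt h 0 x"
        using one_plus_halfplane(2)[OF h, of 0 x] unfolding g_def[abs_def] by simp
      finally have "dt \<psi> 0 x = dt h 0 x * cutoff n R 0 x"
        by simp
      then show "(a 0 x * u0 x + u1 x) * \<psi> 0 x - u0 x * dt \<psi> 0 x
        = ((- dt h 0 x + (1 + h 0 x) * a 0 x) * u0 x + (1 + h 0 x) * u1 x) * cutoff_pow n (x\<^sup>2 / R\<^sup>2)"
        by (simp only:) (simp add: \<psi>_def g_def cutoff_def algebra_simps)
    qed
    finally show ?thesis .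
  qed
  then show ?thesis
    unfolding q_def by blast
qed

section \<open>Nonexistence of global solutions\<close>

lemma cutoff_exponent_exists:
  fixes p :: real
  assumes "1 < p"
  obtains n :: nat where "3 \<le> n" "real n / p \<le> real n - 2"
proof -
  \<comment> \<open>The second condition reads n (1 - 1/p) \<ge> 2, that is, \<open>n\<close> is at
    least twice the conjugate exponent.\<close>
  obtain m :: nat where "2 * p / (p - 1) \<le> real m"
    using real_arch_simple by blast
  moreover define n where "n = max 3 m"
  ultimately have "2 * p / (p - 1) \<le> real n" "3 \<le> n"
    by simp_all
  then have "2 * p \<le> real n * (p - 1)"
    using assms by (simp add: pos_divide_le_eq)
  then have "real n \<le> (real n - 2) * p"
    by (simp add: algebra_simps)
  then have "real n / p \<le> real n - 2"
    using assms by (simp add: pos_divide_le_eq)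
  with \<open>3 \<le> n\<close> show ?thesis
    by (rule that)
qed

lemma no_global_solution:
  assumes p: "1 < p" and \<theta>: "0 < \<theta>" "\<theta> < 1" and k: "1 < k"
    and a: "C2_halfplane a" and h: "C2_halfplane h" and H: "equation_H a h"
    and A: "decay_A k \<delta> a" and B: "bound_B \<theta> k h"
    and u0: "in_H1 u0" and u1: "in_L2 u1"
    and data: "0 < Liminf at_top (\<lambda>R::real. ereal (LINT x:{-R..R}|lborel.
           (- dt h 0 x + (1 + h 0 x) * a 0 x) * u0 x + (1 + h 0 x) * u1 x))"
  shows "\<not> solution_on p a u0 u1 \<infinity> u"
proof
  assume sol: "solution_on p a u0 u1 \<infinity> u"
  obtain n :: nat where n: "3 \<le> n" "real n / p \<le> real n - 2"
    by (rule cutoff_exponent_exists[OF p])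
  define F where "F x = (- dt h 0 x + (1 + h 0 x) * a 0 x) * u0 x + (1 + h 0 x) * u1 x" for x
  obtain E where E: "\<And>R. 1 \<le> R \<Longrightarrow> (LINT x|lborel. F x * cutoff_pow n (x\<^sup>2 / R\<^sup>2)) \<le> E * R powr (1 - p / (p - 1))"
    using data_functional_bound[OF p \<theta> k a h H A B n sol] unfolding F_def by auto
  have at0: "continuous_on UNIV (f 0)" if "continuous_on ({0..} \<times> UNIV) (\<lambda>z. f (fst z) (snd z))"
    for f :: "real \<Rightarrow> real \<Rightarrow> real"
  proof -
    have "continuous_on UNIV (\<lambda>x. (\<lambda>z. f (fst z) (snd z)) (0, x))"
      by (rule continuous_on_compose2[OF that]) (auto intro!: continuous_intros)
    then show ?thesis by simp
  qed
  note c0 = at0[OF C1_halfplane_continuous(1)[OF C2_halfplaneD(1)[OF a]]]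
    at0[OF C1_halfplane_continuous(1)[OF C2_halfplaneD(1)[OF h]]]
    at0[OF C1_halfplane_continuous(2)[OF C2_halfplaneD(1)[OF h]]]
  have u0': "in_L2 u0"
    using u0 by (simp add: in_H1_def)
  have F_int: "integrable lborel (\<lambda>x. indicator {-r..r} x * F x)" for r
  proof -
    have "integrable lborel (\<lambda>x. indicator {-r..r} x * ((- dt h 0 x + (1 + h 0 x) * a 0 x) * u0 x)
        + indicator {-r..r} x * ((1 + h 0 x) * u1 x))"
      by (intro Bochner_Integration.integrable_add integrable_local_mult u0' u1 continuous_intros c0)
    then show ?thesis
      by (simp add: F_def distrib_left)
  qed
  have F_meas: "F \<in> borel_measurable borel"
  proof -
    have [measurable]: "u0 \<in> borel_measurable borel" "u1 \<in> borel_measurable borel"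
      using u0' u1 by (simp_all add: in_L2_def)
    have [measurable]: "(\<lambda>x. - dt h 0 x + (1 + h 0 x) * a 0 x) \<in> borel_measurable borel"
      "(\<lambda>x. 1 + h 0 x) \<in> borel_measurable borel"
      by (intro borel_measurable_continuous_onI continuous_intros c0)+
    show ?thesis
      unfolding F_def[abs_def] by measurable
  qed
  \<comment> \<open>The liminf may be infinite, so an intermediate level is chosen first and then
    replaced by a positive real number.\<close>
  obtain c :: ereal where c: "0 < c" "c < Liminf at_top (\<lambda>R::real. ereal (LINT x:{-R..R}|lborel. F x))"
    using dense[OF data] unfolding F_def by auto
  obtain c' :: real where c': "0 < c'" "ereal c' \<le> c"
    using c by (cases c) (auto intro: that[of 1])
  have "\<forall>\<^sub>F R in at_top. c < ereal (LINT x:{-R..R}|lborel. F x)"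
    using c(2) by (rule less_LiminfD)
  then obtain R0 where R0: "\<And>R. R0 \<le> R \<Longrightarrow> c < ereal (LINT x:{-R..R}|lborel. F x)"
    unfolding eventually_at_top_linorder by blast
  have lower: "c' \<le> (LINT x|lborel. indicator {-r..r} x * F x)" if "R0 \<le> r" for r
    using R0[OF that] c'(2) by (simp add: set_lebesgue_integral_def) (metis ereal_less_eq(3) order_le_less order_le_less_trans)
  have "c' \<le> E * R powr (1 - p / (p - 1))" if "max 1 R0 \<le> R" for R
  proof -
    \<comment> \<open>The average only involves radii from \<open>R\<close> upwards, all of them
      beyond \<open>R0\<close>, so the lower bound survives.\<close>
    have "c' \<le> (LINT x|lborel. F x * cutoff_pow n (x\<^sup>2 / R\<^sup>2))"
      by (rule cutoff_average[OF n(1) _ F_int F_meas lower]) (use that in auto)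
    also have "\<dots> \<le> E * R powr (1 - p / (p - 1))"
      using that by (intro E) simp
    finally show ?thesis .
  qed
  then have ev: "\<forall>\<^sub>F R in at_top. c' \<le> E * R powr (1 - p / (p - 1))"
    unfolding eventually_at_top_linorder by blast
  have "1 - p / (p - 1) < 0"
    using p by simp
  then have "((\<lambda>R::real. R powr (1 - p / (p - 1))) \<longlongrightarrow> 0) at_top"
    by (rule tendsto_neg_powr) (rule filterlim_ident)
  then have "((\<lambda>R. E * R powr (1 - p / (p - 1))) \<longlongrightarrow> E * 0) at_top"
    by (rule tendsto_mult_left)
  then have "c' \<le> E * 0"
    using ev by (intro tendsto_lowerbound) auto
  with c'(1) show False by simp
qed

section \<open>The norm of the solution along almost everywhere equal representatives\<close>

lemma L2_norm_cong:
  assumes "f \<in> borel_measurable lborel" "g \<in> borel_measurable lborel" "AE x in lborel. f x = g x"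
  shows "L2_norm f = L2_norm g"
proof -
  have "(LINT x|lborel. (f x)\<^sup>2) = (LINT x|lborel. (g x)\<^sup>2)"
    by (rule integral_cong_AE) (use assms in auto)
  then show ?thesis by (simp add: L2_norm_def)
qed

lemma has_weak_deriv_cong:
  assumes f: "in_L2 f" and g: "in_L2 g" and eq: "AE x in lborel. f x = g x"
  shows "has_weak_deriv f w \<longleftrightarrow> has_weak_deriv g w"
proof -
  have "(LINT x|lborel. f x * deriv \<phi> x) = (LINT x|lborel. g x * deriv \<phi> x)"
    if "\<phi> C1_differentiable_on UNIV" "compact (closure {x. \<phi> x \<noteq> 0})" for \<phi>
  proof (rule integral_cong_AE)
    have "deriv \<phi> \<in> borel_measurable lborel"
      using test_function_in_L2(2)[OF that] by (simp add: in_L2_def)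
    then show "(\<lambda>x. f x * deriv \<phi> x) \<in> borel_measurable lborel" "(\<lambda>x. g x * deriv \<phi> x) \<in> borel_measurable lborel"
      using f g by (auto simp: in_L2_def)
    show "AE x in lborel. f x * deriv \<phi> x = g x * deriv \<phi> x"
      using eq by eventually_elim simp
  qed
  then show ?thesis
    unfolding has_weak_deriv_def by auto
qed

text \<open>\<open>weak_deriv\<close> is a choice, but functions that agree almost everywhere have
  the same weak derivatives, so the choice operator is applied to the same predicate and returns the
  same function.\<close>

lemma H1_norm_cong:
  assumes f: "in_L2 f" and g: "in_L2 g" and eq: "AE x in lborel. f x = g x"
  shows "H1_norm f = H1_norm g"
  using L2_norm_cong[of f g] assms has_weak_deriv_cong[OF assms]
  by (simp add: H1_norm_def weak_deriv_def in_L2_def)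

text \<open>The two families of difference quotients have equal L2 distances to every candidate
  \<open>w\<close>, so again the choice is made from one and the same predicate.\<close>

lemma L2_time_deriv_cong:
  assumes u: "\<And>s. s \<in> I \<Longrightarrow> in_L2 (u s)" and v: "\<And>s. s \<in> I \<Longrightarrow> in_L2 (v s)"
    and eq: "\<And>s. s \<in> I \<Longrightarrow> AE x in lborel. u s x = v s x" and t: "t \<in> I"
  shows "L2_time_deriv I u t = L2_time_deriv I v t"
proof -
  have "has_L2_time_deriv I u t w \<longleftrightarrow> has_L2_time_deriv I v t w" for w
  proof (cases "in_L2 w")
    case True
    have "L2_norm (\<lambda>x. (u s x - u t x) / (s - t) - w x) = L2_norm (\<lambda>x. (v s x - v t x) / (s - t) - w x)"
      if "s \<in> I" for s
    proof (rule L2_norm_cong)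
      show "AE x in lborel. (u s x - u t x) / (s - t) - w x = (v s x - v t x) / (s - t) - w x"
        using eq[OF that] eq[OF t] by eventually_elim simp
    qed (use u[OF that] u[OF t] v[OF that] v[OF t] True in \<open>auto simp: in_L2_def\<close>)
    then have "\<forall>\<^sub>F s in at t within I. L2_norm (\<lambda>x. (u s x - u t x) / (s - t) - w x)
        = L2_norm (\<lambda>x. (v s x - v t x) / (s - t) - w x)"
      by (auto simp: eventually_at_filter)
    from tendsto_cong[OF this] show ?thesis
      by (simp add: has_L2_time_deriv_def)
  qed (simp add: has_L2_time_deriv_def)
  then show ?thesis
    by (simp add: L2_time_deriv_def)
qed

lemma energy_norm_cong:
  assumes u: "in_X T u" and v: "in_X T v"
    and eq: "\<And>s. s \<in> time_interval T \<Longrightarrow> AE x in lborel. u s x = v s x" and t: "t \<in> time_interval T"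
  shows "energy_norm T u t = energy_norm T v t"
proof -
  have L2: "in_L2 (u s)" "in_L2 (v s)" if "s \<in> time_interval T" for s
    using u v that by (auto simp: in_X_def in_H1_def)
  have "L2_time_deriv (time_interval T) u t = L2_time_deriv (time_interval T) v t"
    using L2 eq t by (rule L2_time_deriv_cong)
  moreover have "H1_norm (u t) = H1_norm (v t)"
    using L2[OF t] eq[OF t] by (rule H1_norm_cong)
  ultimately show ?thesis
    by (simp add: energy_norm_def)
qed

theorem theorem1p3:
  fixes p \<theta> k \<delta>0 \<delta> :: real
    and a h g :: "real \<Rightarrow> real \<Rightarrow> real"
    and u0 u1 :: "real \<Rightarrow> real"
    and T :: ereal
    and u :: "real \<Rightarrow> real \<Rightarrow> real"
  assumes "1 < p" and "0 < \<theta>" and "\<theta> < 1" and "1 < k"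
    and "0 < \<delta>0"
    and "\<And>\<delta>' a'. 0 < \<delta>' \<Longrightarrow> \<delta>' < \<delta>0 \<Longrightarrow> C2_halfplane a' \<Longrightarrow> decay_A k \<delta>' a' \<Longrightarrow>
           \<exists>h'. C2_halfplane h' \<and> equation_H a' h' \<and> bound_B \<theta> k h'"
    and "0 < \<delta>" and "\<delta> < \<delta>0"
    and "C2_halfplane a" and "decay_A k \<delta> a"
    and "C2_halfplane h" and "equation_H a h" and "bound_B \<theta> k h"
    and "g = (\<lambda>t x. 1 + h t x)"
    and "in_H1 u0" and "in_L2 u1"
    and "Liminf at_top (\<lambda>R::real. ereal (LINT x:{-R..R}|lborel.
           (- dt g 0 x + g 0 x * a 0 x) * u0 x + g 0 x * u1 x)) > 0"
    and "local_existence p a"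
    and "local_solution p a u0 u1 T u"
  shows "\<exists>Ts::real. 0 < Ts \<and> T = ereal Ts \<and> filterlim (energy_norm T u) at_top (at_left Ts)"
proof -
  have "0 < T" and sol: "solution_on p a u0 u1 T u"
    and max: "\<And>T' v. solution_on p a u0 u1 T' v \<Longrightarrow> T' \<le> T"
    using \<open>local_solution p a u0 u1 T u\<close> unfolding local_solution_def not_less[symmetric] by blast+
  have "dt g 0 x = dt h 0 x" for x
    unfolding \<open>g = _\<close> using one_plus_halfplane(2)[OF \<open>C2_halfplane h\<close>] by simp
  then have "0 < Liminf at_top (\<lambda>R::real. ereal (LINT x:{-R..R}|lborel.
      (- dt h 0 x + (1 + h 0 x) * a 0 x) * u0 x + (1 + h 0 x) * u1 x))"
    using assms(17) by (simp add: \<open>g = _\<close>)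
  then have "\<not> solution_on p a u0 u1 \<infinity> u"
    using assms by (intro no_global_solution)
  with sol \<open>0 < T\<close> obtain Ts where Ts: "T = ereal Ts" "0 < Ts"
    by (cases T) auto
  \<comment> \<open>Local existence supplies its own maximal solution and states the blow-up
    alternative for that one, which need not be literally \<open>u\<close>.\<close>
  obtain T' v where v: "local_solution p a u0 u1 T' v"
    and uniq: "\<forall>w. solution_on p a u0 u1 T' w \<longrightarrow> (\<forall>t\<in>time_interval T'. AE x in lborel. w t x = v t x)"
    and blow: "\<forall>Ts. T' = ereal Ts \<longrightarrow> filterlim (energy_norm T' v) at_top (at_left Ts)"
    using assms(18)[unfolded local_existence_def, rule_format, OF conjI, OF assms(15,16)] by (elim exE conjE)
  have v_sol: "solution_on p a u0 u1 T' v"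
    using v by (simp add: local_solution_def)
  \<comment> \<open>Neither maximal solution can be outlived by the other, so the two lifespans
    coincide and uniqueness applies on the whole interval.\<close>
  have "T \<le> T'"
    using v sol unfolding local_solution_def by (meson not_less)
  with max[OF v_sol] have "T' = T"
    by simp
  have "energy_norm T u t = energy_norm T v t" if "t \<in> time_interval T" for t
  proof (rule energy_norm_cong[OF _ _ _ that])
    show "in_X T u" "in_X T v"
      using sol v_sol by (simp_all add: solution_on_def \<open>T' = T\<close>)
    show "AE x in lborel. u s x = v s x" if "s \<in> time_interval T" for s
      using uniq sol that by (simp add: \<open>T' = T\<close>)
  qed
  \<comment> \<open>The norms agree on the open interval from 0 to \<open>Ts\<close>, a left
    neighbourhood of \<open>Ts\<close>, which is all that the limit sees.\<close>
  then have "\<forall>\<^sub>F t in at_left Ts. energy_norm T u t = energy_norm T v t"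
    unfolding eventually_at_left[OF Ts(2)] using Ts(2)
    by (intro exI[of _ 0]) (simp add: time_interval_def Ts(1))
  moreover have "filterlim (energy_norm T v) at_top (at_left Ts)"
    using blow Ts(1) by (simp add: \<open>T' = T\<close>)
  ultimately have "filterlim (energy_norm T u) at_top (at_left Ts)"
    using filterlim_cong[OF refl refl] by fastforce
  with Ts show ?thesis by blast
qed

end
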